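(* Let $k,d\in\mathbb N$, let $P$ be a homogeneous unit intensity Poisson process on $\mathbb R^d$ and let $X=\{(t,\rho_k(t,P)^{-1}):t\in P\}$, where $\rho_k(t,I)$ is the distance from $t$ to its $k$th nearest neighbour in $I\setminus\{t\}$. Then the tail configuration of $X$ exists with the scaling function $r(u)=u^{-1}$ (i.e. $\beta=-1$) and is given by $$Y:=\{(U_i,\rho_k(U_i,\mathcal Y)^{-1}):i=0,\dots,k\},$$ where $\mathcal Y:=\{U_0,\dots,U_k\}$, $U_0=0$, and $U_1,\dots,U_k$ are i.i.d. uniform on the unit ball $B_1$ centred at the origin.
   Context: $\mathbb E=\mathbb R^d\times(0,\infty)$; for $(t,s)\in\mathbb E$, $t$ is the position and $s$ the score. A counting measure is a Borel measure on $\mathbb E$ with values in $\{0,1,2,\dots\}\cup\{\infty\}$; it is simple if $\mu(\{t\}\times(0,\infty))\le1$ for all $t\in\mathbb R^d$. Such measures are identified with their sets of atoms, and $\mu(t):=s$ if $(t,s)\in\mu$. $\mathcal B_{11}$ is the family of Borel subsets of $\mathbb E$ contained in $B\times(\varepsilon,\infty)$ for some bounded $B\subset\mathbb R^d$ and $\varepsilon>0$; $\mathcal N$ is the set of simple counting measures finite on $\mathcal B_{11}$. The $\mathcal B_{11}$-vague topology on $\mathcal N$ is the smallest one making $\mu\mapsto\int f\,d\mu$ continuous for all bounded continuous $f:\mathbb E\to\mathbb R$ with support in a set of $\mathcal B_{11}$. Scalings: $T_{v,u}\mu=\sum_{(t,s)\in\mu}\delta_{(t/v,s/u)}$, $u,v>0$.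 The Palm version of $X$ is $\widetilde X=\{(t,\rho_k(t,P+\delta_0)^{-1}):t\in P+\delta_0\}$, with score at the origin $\xi=\widetilde X(0)=\rho_k(0,P+\delta_0)^{-1}$. A random element $Y$ of $\mathcal N$ with $Y(\{0\}\times(1,\infty))=1$ a.s. is the tail configuration of $X$ with respect to a scaling function $r:(0,\infty)\to(0,\infty)$ (regularly varying at infinity with index $\beta$) if $\mathbf P(T_{r(u),u}\widetilde X\in\cdot\mid\xi>u)$ converges weakly to $\mathbf P(Y\in\cdot)$ as $u\to\infty$ with respect to the $\mathcal B_{11}$-vague topology. *)

theory Defs
  imports "HOL-Probability.Probability"
begin

section \<open>Simple counting measures and the vague topology\<close>

text \<open>\<open>'a::euclidean_space\<close> plays the role of \<open>\<real>\<^sup>d\<close>, with \<open>d = DIM('a) \<ge> 1\<close>.\<close>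

definition pos_score_space :: "('a::euclidean_space \<times> real) set" where
  "pos_score_space = UNIV \<times> {0<..}"

definition pos_score_borel :: "('a::euclidean_space \<times> real) measure" where
  "pos_score_borel = restrict_space borel pos_score_space"

definition B11 :: "('a::euclidean_space \<times> real) set set" where
  "B11 = {A \<in> sets pos_score_borel.
            \<exists>B \<epsilon>. bounded B \<and> \<epsilon> > 0 \<and> A \<subseteq> B \<times> {\<epsilon><..}}"

definition counting_measure :: "('a::euclidean_space \<times> real) measure \<Rightarrow> bool" where
  "counting_measure \<mu> \<longleftrightarrow>
     sets \<mu> = sets pos_score_borel \<and>
     (\<forall>A \<in> sets pos_score_borel. emeasure \<mu> A \<in> insert \<infinity> (range of_nat))"

definition simple_measure :: "('a::euclidean_space \<times> real) measure \<Rightarrow> bool" where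
  "simple_measure \<mu> \<longleftrightarrow> (\<forall>t. emeasure \<mu> ({t} \<times> {0<..}) \<le> 1)"

definition configurations :: "('a::euclidean_space \<times> real) measure set" where
  "configurations = {\<mu>. counting_measure \<mu> \<and> simple_measure \<mu> \<and>
                        (\<forall>A \<in> B11. emeasure \<mu> A < \<infinity>)}"

definition atoms :: "('a::euclidean_space \<times> real) measure \<Rightarrow> ('a \<times> real) set" where
  "atoms \<mu> = {x \<in> pos_score_space. emeasure \<mu> {x} \<noteq> 0}"

text \<open>The sum of the Dirac measures at the points of \<open>S \<subseteq> pos_score_space\<close>, as the image of the
  counting measure on \<open>S\<close> under the inclusion.\<close>

definition config_measure :: "('a::euclidean_space \<times> real) set \<Rightarrow> ('a \<times> real) measure" where
  "config_measure S = distr (count_space S) pos_score_borel (\<lambda>x. x)"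

text \<open>The score \<open>\<mu>(t)\<close> of the atom of \<open>\<mu>\<close> at position \<open>t\<close>, with the convention that it is 0 if
  there is none.\<close>

definition score_at :: "('a::euclidean_space \<times> real) measure \<Rightarrow> 'a \<Rightarrow> real" where
  "score_at \<mu> t = (if \<exists>s. (t, s) \<in> atoms \<mu> then THE s. (t, s) \<in> atoms \<mu> else 0)"

definition scaling :: "real \<Rightarrow> real \<Rightarrow> ('a::euclidean_space \<times> real) measure \<Rightarrow> ('a \<times> real) measure"
  where "scaling v u \<mu> = config_measure ((\<lambda>(t, s). (t /\<^sub>R v, s / u)) ` atoms \<mu>)"

text \<open>The support is the closure taken relative to \<open>pos_score_space\<close>.\<close>

definition vague_test_functions :: "('a::euclidean_space \<times> real \<Rightarrow> real) set" where
  "vague_test_functions =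
     {f. continuous_on pos_score_space f \<and> bounded (f ` pos_score_space) \<and>
         (\<exists>A \<in> B11. pos_score_space \<inter> closure {x \<in> pos_score_space. f x \<noteq> 0} \<subseteq> A)}"

definition vague_topology :: "('a::euclidean_space \<times> real) measure topology" where
  "vague_topology = topology_generated_by
     {{\<mu> \<in> configurations. (\<integral>x. f x \<partial>\<mu>) \<in> V} | f V. f \<in> vague_test_functions \<and> open V}"

section \<open>Weak convergence and tail configurations\<close>

definition borel_of_topology :: "'b topology \<Rightarrow> 'b measure" where
  "borel_of_topology T = sigma (topspace T) {V. openin T V}"

definition weakly_converges ::
  "'b topology \<Rightarrow> ('i \<Rightarrow> 'b measure) \<Rightarrow> 'b measure \<Rightarrow> 'i filter \<Rightarrow> bool" where
  "weakly_converges T Q Q' \<F> \<longleftrightarrow>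
     (\<forall>F. continuous_map T euclideanreal F \<and> bounded (F ` topspace T) \<longrightarrow>
          ((\<lambda>i. \<integral>x. F x \<partial>Q i) \<longlongrightarrow> (\<integral>x. F x \<partial>Q')) \<F>)"

definition regularly_varying :: "real \<Rightarrow> (real \<Rightarrow> real) \<Rightarrow> bool" where
  "regularly_varying \<beta> r \<longleftrightarrow>
     r \<in> borel_measurable (restrict_space borel {0<..}) \<and>
     (\<forall>c>0. ((\<lambda>u. r (c * u) / r u) \<longlongrightarrow> c powr \<beta>) at_top)"

text \<open>The random elements \<open>X\<close> and \<open>Y\<close> live on possibly different probability spaces \<open>M\<close> and \<open>M'\<close>;
  \<open>uniform_measure M A\<close> is the conditional probability given the event \<open>A\<close>. The argument \<open>X\<close> is the
  Palm version of the process of which \<open>Y\<close> is the tail configuration.\<close>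

definition tail_configuration_of_palm ::
  "'w measure \<Rightarrow> ('w \<Rightarrow> ('a::euclidean_space \<times> real) measure) \<Rightarrow>
   'v measure \<Rightarrow> ('v \<Rightarrow> ('a \<times> real) measure) \<Rightarrow> (real \<Rightarrow> real) \<Rightarrow> real \<Rightarrow> bool" where
  "tail_configuration_of_palm M X M' Y r \<beta> \<longleftrightarrow>
     prob_space M \<and> X \<in> measurable M (borel_of_topology vague_topology) \<and>
     prob_space M' \<and> Y \<in> measurable M' (borel_of_topology vague_topology) \<and>
     (AE \<omega> in M'. emeasure (Y \<omega>) ({0} \<times> {1<..}) = 1) \<and>
     (\<forall>u>0. r u > 0) \<and> regularly_varying \<beta> r \<and>
     weakly_converges vague_topology
       (\<lambda>u. distr (uniform_measure M {\<omega> \<in> space M. score_at (X \<omega>) 0 > u})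
                  (borel_of_topology vague_topology)
                  (\<lambda>\<omega>. scaling (r u) u (X \<omega>)))
       (distr M' (borel_of_topology vague_topology) Y)
       at_top"

section \<open>Nearest neighbours in a Poisson process\<close>

text \<open>A point process is a random locally finite set of points.\<close>

definition homogeneous_poisson_process ::
  "real \<Rightarrow> 'w measure \<Rightarrow> ('w \<Rightarrow> 'a::euclidean_space set) \<Rightarrow> bool" where
  "homogeneous_poisson_process c M P \<longleftrightarrow>
     prob_space M \<and>
     (\<forall>\<omega> \<in> space M. \<forall>B. bounded B \<longrightarrow> finite (P \<omega> \<inter> B)) \<and>
     (\<forall>B \<in> sets borel. bounded B \<longrightarrow>
        (\<lambda>\<omega>. card (P \<omega> \<inter> B)) \<in> measurable M (count_space UNIV) \<and>
        (\<forall>n. measure M {\<omega> \<in> space M. card (P \<omega> \<inter> B) = n} =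
             (c * measure lborel B) ^ n / fact n * exp (- (c * measure lborel B)))) \<and>
     (\<forall>(n::nat) B. (\<forall>i<n. B i \<in> sets borel \<and> bounded (B i)) \<and> disjoint_family_on B {..<n} \<longrightarrow>
        prob_space.indep_vars M (\<lambda>_. count_space UNIV) (\<lambda>i \<omega>. card (P \<omega> \<inter> B i)) {..<n})"

text \<open>The distance from \<open>t\<close> to its \<open>k\<close>th nearest neighbour in \<open>I - {t}\<close>, for locally finite \<open>I\<close>: the
  smallest radius within which there are \<open>k\<close> such points. It is \<open>\<infinity>\<close> if \<open>I - {t}\<close> has fewer than
  \<open>k\<close> points.\<close>

definition knn_dist :: "nat \<Rightarrow> 'a::euclidean_space \<Rightarrow> 'a set \<Rightarrow> ereal" where
  "knn_dist k t I = (INF r \<in> {r. 0 \<le> r \<and> k \<le> card ((I - {t}) \<inter> cball t r)}. ereal r)"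

text \<open>Points with fewer than \<open>k\<close> neighbours would have score \<open>1/\<infinity> = 0\<close>; intersecting with
  \<open>pos_score_space\<close> drops them. In the processes below this concerns only a null event.\<close>

definition knn_points :: "nat \<Rightarrow> 'a::euclidean_space set \<Rightarrow> ('a \<times> real) set" where
  "knn_points k I = (\<lambda>t. (t, real_of_ereal (inverse (knn_dist k t I)))) ` I \<inter> pos_score_space"

definition knn_process ::
  "nat \<Rightarrow> ('w \<Rightarrow> 'a::euclidean_space set) \<Rightarrow> 'w \<Rightarrow> ('a \<times> real) measure" where
  "knn_process k P \<omega> = config_measure (knn_points k (P \<omega>))"

text \<open>The Palm version of \<open>knn_process k P\<close> for a homogeneous Poisson process \<open>P\<close>.\<close>

definition knn_palm_version ::
  "nat \<Rightarrow> ('w \<Rightarrow> 'a::euclidean_space set) \<Rightarrow> 'w \<Rightarrow> ('a \<times> real) measure" where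
  "knn_palm_version k P = knn_process k (\<lambda>\<omega>. insert 0 (P \<omega>))"

end

theory Submission
  imports Defs
begin

text \<open>Write \<open>Q = u P\<close>, a Poisson process of intensity \<open>c = u\<^sup>-\<^sup>d\<close>. The rescaled Palm configuration is
  the nearest-neighbour configuration of \<open>Q \<union> {0}\<close>, and the score at 0 exceeds \<open>u\<close> iff \<open>Q\<close> has at
  least \<open>k\<close> points in the open unit ball. With \<open>\<lambda> = c |B\<^sub>1|\<close> this has probability at most \<open>\<lambda>\<^sup>k / k!\<close>,
  whereas having exactly \<open>k\<close> points in \<open>B\<^sub>1\<close> and no other point in a ball of radius \<open>R\<close> has probability
  \<open>\<lambda>\<^sup>k / k! \<sqdot> exp (- c |B\<^sub>R|)\<close>; the ratio tends to 1. On the latter event the \<open>k\<close> points are i.i.d.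
  uniform, by comparison of avoidance probabilities, and they determine the configuration on
  \<open>B\<^sub>R \<times> (0, \<infinity>)\<close> when \<open>R \<ge> 3\<close>. Finally, every vaguely open set is a countable union of cylinder
  events, each depending only on finitely many counts over bounded regions. This yields both the
  measurability of all configurations involved and the lower bound on open sets required by the
  portmanteau theorem.\<close>

section \<open>The sigma-algebra of avoidance events\<close>

text \<open>The vague topology is generated by uncountably many integrals, while its Borel sets come
  from arbitrary open sets, so measurability of the subbasic sets does not settle that of an open
  set. The way out is a countable network: for \<open>\<mu>\<close> in an open \<open>W\<close>,
  finitely many exact counts on cells from one countable family already force a configuration into
  \<open>W\<close>. The cells are Borel, not open, which is enough because only probabilities are
  taken of the resulting events. All laws are carried by one space, \<open>point_sets\<close>. Its
  avoidance events are easy to check for a given random set, are closed under intersection, and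
  still determine all counts. Only one-sided estimates are made: the exceedance is bounded from
  above, its intersection with a cylinder event from below. Both bounds carry the same factor
  \<open>\<lambda>^k / k!\<close>, so for every \<open>u > 0\<close> the conditional probability is
  at least \<open>exp (- c |B_R|)\<close> times the limiting one, and this exponential is all that
  remains for the limit \<open>u \<rightarrow> \<infinity>\<close>. The missing upper estimates come
  from applying the lower ones to \<open>- F\<close>.\<close>

definition locally_finite_sets :: "'a::metric_space set set" where
  "locally_finite_sets = {I. \<forall>B. bounded B \<longrightarrow> finite (I \<inter> B)}"

text \<open>This is the usual sigma-algebra generated by the counts on bounded Borel sets, since
  \<open>measurable_card_Int\<close> recovers the counts from the void events. Void events have the
  advantage of being closed under intersection: avoiding \<open>A\<close> and \<open>B\<close> means
  avoiding \<open>A \<union> B\<close>.\<close>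

definition point_sets :: "'a::euclidean_space set measure" where
  "point_sets = sigma locally_finite_sets
     {{I \<in> locally_finite_sets. I \<inter> B = {}} | B. B \<in> sets borel \<and> bounded B}"

lemma space_point_sets [simp]: "space point_sets = locally_finite_sets"
  by (simp add: point_sets_def space_measure_of_conv)

lemma sets_point_sets:
  "sets point_sets = sigma_sets locally_finite_sets
     {{I \<in> locally_finite_sets. I \<inter> B = {}} | B. B \<in> sets borel \<and> bounded B}"
  unfolding point_sets_def by (rule sets_measure_of) auto

lemma finite_Int_bounded: "I \<in> locally_finite_sets \<Longrightarrow> bounded B \<Longrightarrow> finite (I \<inter> B)"
  by (simp add: locally_finite_sets_def)

lemma void_event_in_sets:
  "B \<in> sets borel \<Longrightarrow> bounded B \<Longrightarrow> {I \<in> locally_finite_sets. I \<inter> B = {}} \<in> sets point_sets"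
  unfolding sets_point_sets by (rule sigma_sets.Basic) blast

lemma measurable_point_setsI:
  assumes "\<And>\<omega>. \<omega> \<in> space M \<Longrightarrow> f \<omega> \<in> locally_finite_sets"
    and "\<And>B. B \<in> sets borel \<Longrightarrow> bounded B \<Longrightarrow> {\<omega> \<in> space M. f \<omega> \<inter> B = {}} \<in> sets M"
  shows "f \<in> measurable M point_sets"
  unfolding point_sets_def
proof (rule measurable_measure_of)
  fix Y
  assume "Y \<in> {{I \<in> locally_finite_sets. I \<inter> B = {}} | B::'b set. B \<in> sets borel \<and> bounded B}"
  then obtain B :: "'b set" where "Y = {I \<in> locally_finite_sets. I \<inter> B = {}}" "B \<in> sets borel" "bounded B"
    by blast
  moreover from this have "f -` Y \<inter> space M = {\<omega> \<in> space M. f \<omega> \<inter> B = {}}"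
    using assms(1) by auto
  ultimately show "f -` Y \<inter> space M \<in> sets M"
    using assms(2) by simp
qed (use assms(1) in auto)

text \<open>Distinct points of a finite set have a positive minimal distance \<open>e\<close>, and
  basic neighbourhoods inside balls of radius \<open>e / 2\<close> cannot meet.\<close>

lemma finite_set_separated_by_basis:
  fixes S :: "'a::metric_space set"
  assumes "topological_basis \<B>" "finite S"
  obtains b where "\<And>x. x \<in> S \<Longrightarrow> b x \<in> \<B>" "\<And>x. x \<in> S \<Longrightarrow> x \<in> b x"
    "disjoint_family_on b S"
proof -
  obtain e where e: "e > 0" "\<And>x y. x \<in> S \<Longrightarrow> y \<in> S \<Longrightarrow> x \<noteq> y \<Longrightarrow> e \<le> dist x y"
  proof (cases "\<exists>x\<in>S. \<exists>y\<in>S. x \<noteq> y")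
    case True
    define D where "D = (\<lambda>(x, y). dist x y) ` {(x, y). (x, y) \<in> S \<times> S \<and> x \<noteq> y}"
    have "finite {(x, y). (x, y) \<in> S \<times> S \<and> x \<noteq> y}"
      by (rule finite_subset[of _ "S \<times> S"]) (use assms(2) in auto)
    then have fin: "finite D"
      by (simp add: D_def)
    have "D \<noteq> {}" using True by (auto simp: D_def)
    then have "Min D > 0" using fin by (auto simp: D_def)
    moreover have "Min D \<le> dist x y" if "x \<in> S" "y \<in> S" "x \<noteq> y" for x y
      by (rule Min_le[OF fin]) (use that in \<open>auto simp: D_def\<close>)
    ultimately show ?thesis using that by blast
  next
    case False
    then show ?thesis using that[of 1] by force
  qed
  have "\<exists>b\<in>\<B>. x \<in> b \<and> b \<subseteq> ball x (e / 2)" for x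
    using topological_basisE[OF assms(1), of "ball x (e / 2)" x] e(1)
    by (metis centre_in_ball half_gt_zero open_ball)
  then obtain b where b: "\<And>x. b x \<in> \<B>" "\<And>x. x \<in> b x" "\<And>x. b x \<subseteq> ball x (e / 2)"
    by metis
  have "b x \<inter> b y = {}" if "x \<in> S" "y \<in> S" "x \<noteq> y" for x y
  proof (rule ccontr)
    assume "b x \<inter> b y \<noteq> {}"
    then obtain z where "dist x z < e / 2" "dist y z < e / 2"
      using b(3) by (auto simp: subset_iff)
    then have "dist x y < e"
      by (intro dist_triangle_half_l[of x z e y]) (simp_all add: dist_commute)
    then show False
      using e(2)[OF that] by simp
  qed
  then show ?thesis
    using b by (intro that[of b]) (auto simp: disjoint_family_on_def)
qed

text \<open>At least \<open>n\<close> points of \<open>I\<close> lie in \<open>B\<close> iff some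
  \<open>n\<close> pairwise disjoint basic open sets all meet \<open>I \<inter> B\<close>. A
  countable basis has only countably many finite subfamilies, and meeting a set is the complement of
  a void event.\<close>

lemma card_Int_ge_event:
  fixes B :: "'a::euclidean_space set"
  assumes B: "B \<in> sets borel" "bounded B"
  shows "{I \<in> locally_finite_sets. n \<le> card (I \<inter> B)} \<in> sets point_sets"
proof -
  obtain \<B> :: "'a set set" where \<B>: "countable \<B>" "topological_basis \<B>"
    using ex_countable_basis by blast
  define \<FF> where "\<FF> = {F. F \<subseteq> \<B> \<and> finite F \<and> disjoint F \<and> card F = n}"
  have "countable \<FF>"
    unfolding \<FF>_def
    by (rule countable_subset[OF _ countable_Collect_finite_subset[OF \<B>(1)]]) auto
  have meas: "{I \<in> locally_finite_sets. I \<inter> (B \<inter> b) \<noteq> {}} \<in> sets point_sets" if "b \<in> \<B>" for b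
  proof -
    have "b \<in> sets borel" using that \<B>(2) by (simp add: topological_basis_open)
    then have "{I \<in> locally_finite_sets. I \<inter> (B \<inter> b) = {}} \<in> sets point_sets"
      using B by (intro void_event_in_sets) (auto intro: bounded_subset)
    then have "space point_sets - {I \<in> locally_finite_sets. I \<inter> (B \<inter> b) = {}} \<in> sets point_sets"
      by blast
    then show ?thesis by (simp add: set_diff_eq) (metis (no_types, lifting) Collect_cong)
  qed
  have "n \<le> card (I \<inter> B) \<longleftrightarrow> (\<exists>F\<in>\<FF>. \<forall>b\<in>F. I \<inter> (B \<inter> b) \<noteq> {})"
    if I: "I \<in> locally_finite_sets" for I :: "'a set"
  proof
    assume "n \<le> card (I \<inter> B)"
    then obtain S where S: "S \<subseteq> I \<inter> B" "card S = n" "finite S"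
      using obtain_subset_with_card_n by metis
    obtain b where b: "\<And>x. x \<in> S \<Longrightarrow> b x \<in> \<B>" "\<And>x. x \<in> S \<Longrightarrow> x \<in> b x" "disjoint_family_on b S"
      using finite_set_separated_by_basis[OF \<B>(2) S(3)] by blast
    have "inj_on b S"
      using b(2,3) by (fastforce simp: inj_on_def disjoint_family_on_def)
    then have "card (b ` S) = n" using S by (simp add: card_image)
    moreover have "disjoint (b ` S)"
      using b(3) by (rule disjoint_family_on_disjoint_image)
    ultimately have "b ` S \<in> \<FF>"
      using b(1) S(3) by (auto simp: \<FF>_def)
    then show "\<exists>F\<in>\<FF>. \<forall>b\<in>F. I \<inter> (B \<inter> b) \<noteq> {}"
      using b(2) S(1) by (intro bexI[of _ "b ` S"]) auto
  next
    assume "\<exists>F\<in>\<FF>. \<forall>b\<in>F. I \<inter> (B \<inter> b) \<noteq> {}"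
    then obtain F where F: "F \<in> \<FF>" and "\<forall>b\<in>F. \<exists>x. x \<in> I \<inter> B \<and> x \<in> b"
      by blast
    then obtain x where x: "\<And>b. b \<in> F \<Longrightarrow> x b \<in> I \<inter> B" "\<And>b. b \<in> F \<Longrightarrow> x b \<in> b"
      by metis
    have "inj_on x F"
    proof (rule inj_onI, rule ccontr)
      fix b c assume bc: "b \<in> F" "c \<in> F" "x b = x c" "b \<noteq> c"
      then have "b \<inter> c = {}" using F by (auto simp: \<FF>_def disjoint_def)
      then show False using x(2)[OF bc(1)] x(2)[OF bc(2)] bc(3) by auto
    qed
    then have "card F \<le> card (I \<inter> B)"
      using x(1) finite_Int_bounded[OF I B(2)] by (intro card_inj_on_le) auto
    then show "n \<le> card (I \<inter> B)" using F by (simp add: \<FF>_def)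
  qed
  then have "{I \<in> locally_finite_sets. n \<le> card (I \<inter> B)} =
      (\<Union>F\<in>\<FF>. {I \<in> space point_sets. \<forall>b\<in>F. I \<inter> (B \<inter> b) \<noteq> {}})"
    by auto
  also have "\<dots> \<in> sets point_sets"
  proof (rule sets.countable_UN'[OF \<open>countable \<FF>\<close>])
    have "{I \<in> space point_sets. \<forall>b\<in>F. I \<inter> (B \<inter> b) \<noteq> {}} \<in> sets point_sets" if "F \<in> \<FF>" for F
      using that meas by (intro sets.sets_Collect_finite_All) (auto simp: \<FF>_def)
    then show "(\<lambda>F. {I \<in> space point_sets. \<forall>b\<in>F. I \<inter> (B \<inter> b) \<noteq> {}}) ` \<FF> \<subseteq> sets point_sets"
      by blast
  qed
  finally show ?thesis .
qed

lemma measurable_countI: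
  fixes f :: "'b \<Rightarrow> nat"
  assumes "\<And>n. {\<omega> \<in> space M. n \<le> f \<omega>} \<in> sets M"
  shows "f \<in> measurable M (count_space UNIV)"
proof (subst measurable_count_space_eq2_countable, simp, safe)
  fix n
  have "f -` {n} \<inter> space M = {\<omega> \<in> space M. n \<le> f \<omega>} - {\<omega> \<in> space M. Suc n \<le> f \<omega>}"
    by auto
  also have "\<dots> \<in> sets M" using assms by blast
  finally show "f -` {n} \<inter> space M \<in> sets M" .
qed

lemma measurable_card_Int [measurable]:
  fixes B :: "'a::euclidean_space set"
  assumes "B \<in> sets borel" "bounded B"
  shows "(\<lambda>I. card (I \<inter> B)) \<in> measurable point_sets (count_space UNIV)"
  by (rule measurable_countI) (use card_Int_ge_event[OF assms] in simp)

text \<open>Dividing by the total number of points in \<open>B\<close> makes \<open>I \<mapsto> \<Sum>\<^sub>t \<delta>\<^sub>t\<close> a subprobability kernel,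
  so that the section theorems for such kernels apply.\<close>

lemma measurable_card_Int_section:
  fixes B :: "'a::euclidean_space set"
  assumes B: "B \<in> sets borel" "bounded B" and g: "g \<in> measurable N point_sets"
    and A: "(SIGMA y:space N. A y) \<in> sets (N \<Otimes>\<^sub>M borel)"
  shows "(\<lambda>y. card (g y \<inter> B \<inter> A y)) \<in> measurable N (count_space UNIV)"
proof -
  define L where "L I = distr (uniform_count_measure (I \<inter> B)) borel (\<lambda>x. x)" for I :: "'a set"
  have L: "emeasure (L I) C = ennreal (card (I \<inter> B \<inter> C) / card (I \<inter> B))"
    if "I \<in> locally_finite_sets" "C \<in> sets borel" for I C
  proof -
    have fin: "finite (I \<inter> B)" using that B(2) by (simp add: finite_Int_bounded)
    have "emeasure (L I) C = emeasure (uniform_count_measure (I \<inter> B)) (C \<inter> (I \<inter> B))"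
      unfolding L_def using that(2)
      by (subst emeasure_distr) (auto simp: uniform_count_measure_def point_measure_def measurable_def)
    also have "\<dots> = ennreal (card (C \<inter> (I \<inter> B)) / card (I \<inter> B))"
      by (subst emeasure_uniform_count_measure[OF fin]) auto
    finally show ?thesis by (simp add: Int_commute)
  qed
  have Lm: "L \<in> measurable point_sets (subprob_algebra borel)"
  proof (rule measurable_subprob_algebra)
    fix I :: "'a set" assume I: "I \<in> space point_sets"
    show "subprob_space (L I)"
    proof (rule subprob_spaceI)
      \<comment> \<open>For empty \<open>I \<inter> B\<close> the quotient is
        \<open>0 / 0 = 0\<close> and \<open>L I\<close> is the zero measure; hence a
        subprobability.\<close>
      have "real (card (I \<inter> B)) / real (card (I \<inter> B)) \<le> 1" by simp
      moreover have "space (L I) = UNIV" by (simp add: L_def)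
      moreover have "emeasure (L I) UNIV = ennreal (real (card (I \<inter> B)) / real (card (I \<inter> B)))"
        using L[of I UNIV] I by simp
      ultimately show "emeasure (L I) (space (L I)) \<le> 1"
        by (simp only: ennreal_le_1)
    qed (simp add: L_def)
    show "sets (L I) = sets borel" by (simp add: L_def)
  next
    fix C :: "'a set" assume C: "C \<in> sets borel"
    have "(\<lambda>I. ennreal (real (card (I \<inter> (B \<inter> C))) / real (card (I \<inter> B)))) \<in> borel_measurable point_sets"
    proof -
      have [measurable]: "(\<lambda>I. card (I \<inter> (B \<inter> C))) \<in> measurable point_sets (count_space UNIV)"
        using B C by (intro measurable_card_Int) (auto intro: bounded_subset)
      have [measurable]: "(\<lambda>I. card (I \<inter> B)) \<in> measurable point_sets (count_space UNIV)"
        by (intro measurable_card_Int B)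
      show ?thesis by measurable
    qed
    then show "(\<lambda>I. emeasure (L I) C) \<in> borel_measurable point_sets"
      by (rule measurable_cong[THEN iffD1, rotated]) (use C in \<open>simp add: L Int_assoc\<close>)
  qed
  have e: "(\<lambda>y. emeasure (L (g y)) (A y)) \<in> borel_measurable N"
    by (rule emeasure_measurable_subprob_algebra2[OF A]) (rule measurable_compose[OF g Lm])
  have "(\<lambda>y. card (g y \<inter> B)) \<in> measurable N (count_space UNIV)"
    by (rule measurable_compose[OF g measurable_card_Int[OF B]])
  then have c: "(\<lambda>y. real (card (g y \<inter> B))) \<in> borel_measurable N"
    by (rule measurable_compose) simp
  have eq: "real (card (g y \<inter> B \<inter> A y)) = enn2real (emeasure (L (g y)) (A y)) * real (card (g y \<inter> B))"
    if y: "y \<in> space N" for y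
  proof -
    have gy: "g y \<in> locally_finite_sets" using measurable_space[OF g y] by simp
    have "A y = Pair y -` (SIGMA y:space N. A y)" using y by auto
    then have "A y \<in> sets borel" using sets_Pair1[OF A, of y] by simp
    then have "emeasure (L (g y)) (A y) = ennreal (card (g y \<inter> B \<inter> A y) / card (g y \<inter> B))"
      using gy by (simp add: L)
    \<comment> \<open>The normalisation cannot be undone when the divisor is 0, but then the count
      itself vanishes.\<close>
    moreover have "card (g y \<inter> B \<inter> A y) = 0" if "card (g y \<inter> B) = 0"
      using that finite_Int_bounded[OF gy B(2)] by auto
    ultimately show ?thesis by auto
  qed
  have m: "(\<lambda>y. real (card (g y \<inter> B \<inter> A y))) \<in> borel_measurable N"
    by (rule measurable_cong[THEN iffD2, rotated, OF borel_measurable_times[OF borel_measurable_enn2real[OF e] c]])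
      (rule eq)
  show ?thesis
  proof (rule measurable_countI)
    fix n
    have "{y \<in> space N. real n \<le> real (card (g y \<inter> B \<inter> A y))} \<in> sets N"
      using m unfolding borel_measurable_iff_ge by blast
    then show "{y \<in> space N. n \<le> card (g y \<inter> B \<inter> A y)} \<in> sets N" by simp
  qed
qed

section \<open>Nearest-neighbour configurations\<close>

text \<open>The infimum runs over closed balls, the criterion uses an open one: the finitely many
  points of \<open>ball t a\<close> have a largest distance from \<open>t\<close>, which is still
  below \<open>a\<close>. By \<open>k \<ge> 1\<close> there is such a point, so that
  \<open>Max\<close> is meaningful.\<close>

lemma knn_dist_less_iff:
  assumes I: "I \<in> locally_finite_sets" and k: "k \<ge> 1"
  shows "knn_dist k t I < ereal a \<longleftrightarrow> k \<le> card ((I - {t}) \<inter> ball t a)"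
proof
  assume "knn_dist k t I < ereal a"
  then obtain r where r: "0 \<le> r" "k \<le> card ((I - {t}) \<inter> cball t r)" "r < a"
    by (auto simp: knn_dist_def INF_less_iff)
  have "card ((I - {t}) \<inter> cball t r) \<le> card ((I - {t}) \<inter> ball t a)"
    by (rule card_mono)
      (use r(3) finite_Int_bounded[OF I bounded_ball, of t a] in \<open>auto intro: rev_finite_subset\<close>)
  then show "k \<le> card ((I - {t}) \<inter> ball t a)" using r(2) by simp
next
  assume k': "k \<le> card ((I - {t}) \<inter> ball t a)"
  define F where "F = (I - {t}) \<inter> ball t a"
  have F: "finite F" "F \<noteq> {}"
    using finite_Int_bounded[OF I bounded_ball, of t a] k k'
    by (auto simp: F_def intro: rev_finite_subset)
  define r where "r = Max (dist t ` F)"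
  have r: "r \<in> dist t ` F" unfolding r_def by (rule Max_in) (use F in auto)
  have le: "dist t x \<le> r" if "x \<in> F" for x
    unfolding r_def by (rule Max_ge) (use that F in auto)
  have "F \<subseteq> (I - {t}) \<inter> cball t r"
  proof
    fix x assume "x \<in> F"
    with le[OF this] show "x \<in> (I - {t}) \<inter> cball t r" unfolding F_def by auto
  qed
  then have "card F \<le> card ((I - {t}) \<inter> cball t r)"
    using finite_Int_bounded[OF I bounded_cball, of t r]
    by (intro card_mono) (auto intro: rev_finite_subset)
  then have "r \<in> {r. 0 \<le> r \<and> k \<le> card ((I - {t}) \<inter> cball t r)}"
    using r k' by (auto simp: F_def)
  then have "knn_dist k t I \<le> ereal r"
    unfolding knn_dist_def by (rule INF_lower)
  also have "ereal r < ereal a" using r by (auto simp: F_def)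
  finally show "knn_dist k t I < ereal a" .
qed

text \<open>The countable form needed for measurability. The condition
  \<open>ereal q \<le> y\<close> may be non-strict because the open ball already gives
  \<open>knn_dist k t I < ereal q\<close>.\<close>

lemma knn_dist_less_iff_rational:
  assumes I: "I \<in> locally_finite_sets" and k: "k \<ge> 1"
  shows "knn_dist k t I < y \<longleftrightarrow> (\<exists>q\<in>\<rat>. ereal q \<le> y \<and> k \<le> card ((I - {t}) \<inter> ball t q))"
proof
  assume "knn_dist k t I < y"
  then obtain q where "knn_dist k t I < ereal (real_of_rat q)" "ereal (real_of_rat q) < y"
    using ereal_dense3 by blast
  then show "\<exists>q\<in>\<rat>. ereal q \<le> y \<and> k \<le> card ((I - {t}) \<inter> ball t q)"
    using knn_dist_less_iff[OF I k] by (intro bexI[of _ "real_of_rat q"]) auto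
next
  assume "\<exists>q\<in>\<rat>. ereal q \<le> y \<and> k \<le> card ((I - {t}) \<inter> ball t q)"
  then obtain q where "ereal q \<le> y" "knn_dist k t I < ereal q"
    using knn_dist_less_iff[OF I k] by auto
  then show "knn_dist k t I < y" by simp
qed

lemma knn_dist_pos:
  assumes I: "I \<in> locally_finite_sets" and k: "k \<ge> 1"
  shows "0 < knn_dist k t I"
proof -
  have "finite (I \<inter> ball t 1)" by (rule finite_Int_bounded[OF I bounded_ball])
  then obtain d where d: "d > 0" "\<forall>x\<in>I \<inter> ball t 1. x \<noteq> t \<longrightarrow> d \<le> dist t x"
    using finite_set_avoid by blast
  have "(I - {t}) \<inter> ball t (min d 1) = {}"
    using d by fastforce
  then have "\<not> knn_dist k t I < ereal (min d 1)"
    using k by (subst knn_dist_less_iff[OF I k]) auto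
  moreover have "(0::ereal) < ereal (min d 1)" using d by simp
  ultimately show ?thesis by (metis not_less order_less_le_trans)
qed

text \<open>A distance \<open>\<infinity>\<close> has inverse 0 and fails both sides. A distance 0
  would have inverse \<open>\<infinity>\<close>, which \<open>real_of_ereal\<close> turns into 0,
  and would break the equivalence; \<open>knn_dist_pos\<close> excludes it.\<close>

lemma knn_score_gt_iff:
  assumes "I \<in> locally_finite_sets" "k \<ge> 1" "u > 0"
  shows "real_of_ereal (inverse (knn_dist k t I)) > u \<longleftrightarrow> knn_dist k t I < ereal (inverse u)"
  using knn_dist_pos[OF assms(1,2), of t] assms(3)
  by (cases "knn_dist k t I") (auto simp: field_simps)

text \<open>The event \<open>knn_dist k t I < y\<close> is a countable disjunction, over rational
  radii \<open>q\<close>, of conditions on the count in \<open>ball t q - {t}\<close>. These balls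
  move with \<open>t\<close>, whereas \<open>measurable_card_Int_section\<close> counts inside a
  fixed bounded set; hence the exhaustion by \<open>ball 0 n\<close>.\<close>

lemma measurable_knn_dist [measurable]:
  assumes k: "k \<ge> 1"
  shows "(\<lambda>(I, t). knn_dist k t I) \<in> borel_measurable (point_sets \<Otimes>\<^sub>M (borel :: 'a::euclidean_space measure))"
    (is "?f \<in> borel_measurable ?N")
proof (rule borel_measurableI_less)
  fix y :: ereal
  have meas: "{z \<in> space ?N. k \<le> card (fst z \<inter> ball 0 (real n) \<inter> (ball (snd z) q - {snd z}))} \<in> sets ?N"
    for q n
  proof -
    have "(SIGMA z:space ?N. ball (snd z) q - {snd z})
        = {p \<in> space (?N \<Otimes>\<^sub>M borel). dist (snd (fst p)) (snd p) < q \<and> snd p \<noteq> snd (fst p)}"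
      by (auto simp: space_pair_measure)
    also have "\<dots> \<in> sets (?N \<Otimes>\<^sub>M borel)" by measurable
    finally have "(\<lambda>z. card (fst z \<inter> ball 0 (real n) \<inter> (ball (snd z) q - {snd z})))
        \<in> measurable ?N (count_space UNIV)"
      by (intro measurable_card_Int_section) auto
    then show ?thesis by measurable
  qed
  have "{z \<in> space ?N. ?f z < y} =
      (\<Union>q\<in>{q\<in>\<rat>. ereal q \<le> y}. \<Union>n.
        {z \<in> space ?N. k \<le> card (fst z \<inter> ball 0 (real n) \<inter> (ball (snd z) q - {snd z}))})"
  proof -
    have "knn_dist k t I < y \<longleftrightarrow>
        (\<exists>q\<in>\<rat>. ereal q \<le> y \<and> (\<exists>n. k \<le> card (I \<inter> ball 0 (real n) \<inter> (ball t q - {t}))))"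
      if I: "I \<in> locally_finite_sets" for I and t :: 'a
    proof -
      have "k \<le> card ((I - {t}) \<inter> ball t q) \<longleftrightarrow> (\<exists>n. k \<le> card (I \<inter> ball 0 (real n) \<inter> (ball t q - {t})))"
        for q
      proof
        assume *: "k \<le> card ((I - {t}) \<inter> ball t q)"
        obtain n where n: "norm t + \<bar>q\<bar> < real n" using reals_Archimedean2 by blast
        have "dist 0 x < real n" if "dist t x < q" for x
          using that n norm_triangle_sub[of x t] by (simp add: dist_norm norm_minus_commute)
        then have "(I - {t}) \<inter> ball t q = I \<inter> ball 0 (real n) \<inter> (ball t q - {t})"
          by auto
        then show "\<exists>n. k \<le> card (I \<inter> ball 0 (real n) \<inter> (ball t q - {t}))" using * by auto
      next
        assume "\<exists>n. k \<le> card (I \<inter> ball 0 (real n) \<inter> (ball t q - {t}))"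
        then obtain n where "k \<le> card (I \<inter> ball 0 (real n) \<inter> (ball t q - {t}))" ..
        also have "\<dots> \<le> card ((I - {t}) \<inter> ball t q)"
          by (rule card_mono)
            (use finite_Int_bounded[OF I bounded_ball, of t q] in \<open>auto intro: rev_finite_subset\<close>)
        finally show "k \<le> card ((I - {t}) \<inter> ball t q)" .
      qed
      then show ?thesis by (simp add: knn_dist_less_iff_rational[OF I k])
    qed
    then show ?thesis
      unfolding space_pair_measure space_point_sets by (auto simp del: mem_ball) blast+
  qed
  also have "\<dots> \<in> sets ?N"
    by (intro sets.countable_UN' sets.countable_UN)
      (use meas in \<open>auto intro: countable_subset[OF _ countable_rat]\<close>)
  finally show "{z \<in> space ?N. ?f z < y} \<in> sets ?N" .
qed

section \<open>Point measures on positions and scores\<close>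

lemma pos_score_space_borel: "pos_score_space \<in> sets borel"
  unfolding pos_score_space_def by (intro borel_open open_Times) auto

lemma space_pos_score_borel [simp]: "space pos_score_borel = pos_score_space"
  by (simp add: pos_score_borel_def space_restrict_space)

lemma sets_pos_score_borel_iff:
  "A \<in> sets pos_score_borel \<longleftrightarrow> A \<in> sets borel \<and> A \<subseteq> pos_score_space"
  unfolding pos_score_borel_def by (subst sets_restrict_space_iff) (auto simp: pos_score_space_borel)

lemma sets_config_measure [simp]: "sets (config_measure S) = sets pos_score_borel"
  by (simp add: config_measure_def)

lemma emeasure_config_measure:
  assumes "S \<subseteq> pos_score_space" "A \<in> sets pos_score_borel"
  shows "emeasure (config_measure S) A = emeasure (count_space UNIV) (S \<inter> A)"
proof -
  have "emeasure (config_measure S) A = emeasure (count_space S) (A \<inter> S)"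
    unfolding config_measure_def
    by (subst emeasure_distr) (use assms in \<open>auto simp: measurable_def\<close>)
  also have "\<dots> = emeasure (count_space UNIV) (S \<inter> A)"
    by (simp add: emeasure_count_space Int_commute)
  finally show ?thesis .
qed

lemma atoms_config_measure:
  assumes "S \<subseteq> pos_score_space"
  shows "atoms (config_measure S) = S"
proof -
  have "emeasure (config_measure S) {x} \<noteq> 0 \<longleftrightarrow> x \<in> S" if "x \<in> pos_score_space" for x
    using that assms
    by (subst emeasure_config_measure)
      (auto simp: sets_pos_score_borel_iff emeasure_count_space)
  then show ?thesis using assms by (auto simp: atoms_def)
qed

text \<open>Injectivity of \<open>fst\<close> gives simplicity. Finiteness is asked over bounded
  sets of positions without a lower bound on the score, which implies finiteness on
  \<open>B11\<close> and holds whenever the positions are locally finite.\<close>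

lemma config_measure_in_configurations:
  fixes S :: "('a::euclidean_space \<times> real) set"
  assumes S: "S \<subseteq> pos_score_space" "inj_on fst S"
    and fin: "\<And>B. bounded B \<Longrightarrow> finite (S \<inter> B \<times> UNIV)"
  shows "config_measure S \<in> configurations"
proof -
  have "emeasure (config_measure S) A \<in> insert \<infinity> (range of_nat)" if "A \<in> sets pos_score_borel" for A
    using that by (auto simp: emeasure_config_measure[OF S(1)] emeasure_count_space)
  moreover have "emeasure (config_measure S) ({t} \<times> {0<..}) \<le> 1" for t
  proof -
    have "{t} \<times> {0::real<..} \<in> sets pos_score_borel"
      unfolding sets_pos_score_borel_iff pos_score_space_def by (auto intro: borel_Times)
    moreover have "S \<inter> {t} \<times> {0<..} \<subseteq> {THE x. x \<in> S \<and> fst x = t}"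
    proof
      fix x assume x: "x \<in> S \<inter> {t} \<times> {0<..}"
      have "(THE x. x \<in> S \<and> fst x = t) = x"
        by (rule the_equality) (use x S(2) in \<open>force simp: inj_on_def\<close>)+
      then show "x \<in> {THE x. x \<in> S \<and> fst x = t}" by simp
    qed
    then obtain x0 where x0: "S \<inter> {t} \<times> {0<..} \<subseteq> {x0}" by blast
    have "finite (S \<inter> {t} \<times> {0<..})" "card (S \<inter> {t} \<times> {0<..}) \<le> 1"
      using finite_subset[OF x0] card_mono[OF _ x0] by simp_all
    ultimately show ?thesis
      by (simp add: emeasure_config_measure[OF S(1)] emeasure_count_space)
  qed
  moreover have "emeasure (config_measure S) A < \<infinity>" if "A \<in> B11" for A
  proof -
    obtain B \<epsilon> where A: "A \<in> sets pos_score_borel" "bounded B" "A \<subseteq> B \<times> {\<epsilon><..}"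
      using \<open>A \<in> B11\<close> by (auto simp: B11_def)
    have "finite (S \<inter> A)"
      by (rule finite_subset[OF _ fin[OF A(2)]]) (use A(3) in auto)
    then show ?thesis
      using A(1) by (simp add: emeasure_config_measure[OF S(1)] emeasure_count_space less_top[symmetric])
  qed
  ultimately show ?thesis
    by (auto simp: configurations_def counting_measure_def simple_measure_def)
qed

text \<open>\<open>knn_process\<close> as a map of the point set alone, so that all randomness
  enters through a measurable map into \<open>point_sets\<close>.\<close>

definition knn_config :: "nat \<Rightarrow> 'a::euclidean_space set \<Rightarrow> ('a \<times> real) measure" where
  "knn_config k I = config_measure (knn_points k I)"

lemma knn_points_subset: "knn_points k I \<subseteq> pos_score_space"
  by (simp add: knn_points_def)

lemma knn_config_in_configurations:
  assumes "I \<in> locally_finite_sets"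
  shows "knn_config k I \<in> configurations"
  unfolding knn_config_def
proof (rule config_measure_in_configurations[OF knn_points_subset])
  show "inj_on fst (knn_points k I)"
    by (auto simp: knn_points_def inj_on_def)
  fix B :: "'a set" assume "bounded B"
  then have "finite ((\<lambda>t. (t, real_of_ereal (inverse (knn_dist k t I)))) ` (I \<inter> B))"
    using assms by (intro finite_imageI finite_Int_bounded)
  then show "finite (knn_points k I \<inter> B \<times> UNIV)"
    by (rule rev_finite_subset) (auto simp: knn_points_def)
qed

text \<open>The atoms form the graph of a function of the position, so counting atoms in
  \<open>A\<close> is counting positions in a section that depends on \<open>I\<close>; this is the
  form that \<open>measurable_card_Int_section\<close> handles.\<close>

lemma emeasure_knn_config:
  assumes "I \<in> locally_finite_sets" "A \<in> sets pos_score_borel" "bounded B" "A \<subseteq> B \<times> UNIV"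
  shows "emeasure (knn_config k I) A =
    of_nat (card (I \<inter> B \<inter> {t. (t, real_of_ereal (inverse (knn_dist k t I))) \<in> A}))"
proof -
  let ?g = "\<lambda>t. (t, real_of_ereal (inverse (knn_dist k t I)))"
  have fin: "finite (I \<inter> B)" by (rule finite_Int_bounded) fact+
  have "knn_points k I \<inter> A = ?g ` (I \<inter> B \<inter> {t. ?g t \<in> A})"
    using assms(2,4) by (auto simp: knn_points_def sets_pos_score_borel_iff)
  moreover have "inj_on ?g (I \<inter> B \<inter> {t. ?g t \<in> A})" by (auto simp: inj_on_def)
  ultimately have "finite (knn_points k I \<inter> A)"
      "card (knn_points k I \<inter> A) = card (I \<inter> B \<inter> {t. ?g t \<in> A})"
    using fin by (simp_all add: card_image)
  then show ?thesis
    unfolding knn_config_def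
    by (simp add: emeasure_config_measure[OF knn_points_subset assms(2)] emeasure_count_space)
qed

lemma measurable_emeasure_knn_config:
  fixes A :: "('a::euclidean_space \<times> real) set"
  assumes k: "k \<ge> 1" and A: "A \<in> B11"
  shows "(\<lambda>I. emeasure (knn_config k I) A) \<in> borel_measurable point_sets"
proof -
  obtain B0 \<epsilon> where A0: "A \<in> sets pos_score_borel" "bounded B0" "A \<subseteq> B0 \<times> {\<epsilon><..}"
    using A by (auto simp: B11_def)
  obtain R where R: "B0 \<subseteq> ball 0 R" using bounded_subset_ballD[OF A0(2), of 0] by auto
  define B :: "'a set" where "B = ball 0 R"
  have B: "B \<in> sets borel" "bounded B" "A \<subseteq> B \<times> UNIV" using A0(3) R by (auto simp: B_def)
  have [measurable]: "A \<in> sets borel" using A0(1) by (simp add: sets_pos_score_borel_iff)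
  have "(SIGMA I:space point_sets. {t. (t, real_of_ereal (inverse (knn_dist k t I))) \<in> A})
      = {p \<in> space (point_sets \<Otimes>\<^sub>M borel). (snd p, real_of_ereal (inverse ((\<lambda>(I, t). knn_dist k t I) p))) \<in> A}"
    by (auto simp: space_pair_measure)
  also have "\<dots> \<in> sets (point_sets \<Otimes>\<^sub>M borel)"
  proof -
    note measurable_knn_dist[OF k, measurable]
    have "(\<lambda>p. (snd p, real_of_ereal (inverse ((\<lambda>(I, t). knn_dist k t I) p))))
      \<in> measurable (point_sets \<Otimes>\<^sub>M (borel :: 'a measure)) (borel \<Otimes>\<^sub>M borel)"
      by measurable
    then have "(\<lambda>p. (snd p, real_of_ereal (inverse ((\<lambda>(I, t). knn_dist k t I) p))))
      \<in> measurable (point_sets \<Otimes>\<^sub>M (borel :: 'a measure)) borel"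
      by (simp add: borel_prod)
    then show ?thesis by measurable
  qed
  finally have "(\<lambda>I. card (I \<inter> B \<inter> {t. (t, real_of_ereal (inverse (knn_dist k t I))) \<in> A}))
      \<in> measurable point_sets (count_space UNIV)"
    by (intro measurable_card_Int_section B) auto
  then have "(\<lambda>I. of_nat (card (I \<inter> B \<inter> {t. (t, real_of_ereal (inverse (knn_dist k t I))) \<in> A})) :: ennreal)
      \<in> borel_measurable point_sets"
    by (rule measurable_compose) simp
  then show ?thesis
    by (rule measurable_cong[THEN iffD1, rotated])
      (use emeasure_knn_config[OF _ A0(1) B(2,3)] in simp)
qed

section \<open>Cylinder events and vaguely open sets\<close>

lemma B11_subset: "A \<in> sets pos_score_borel \<Longrightarrow> A \<subseteq> A' \<Longrightarrow> A' \<in> B11 \<Longrightarrow> A \<in> B11"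
  unfolding B11_def by blast

lemma empty_in_B11: "{} \<in> B11"
  unfolding B11_def by (auto intro!: exI[of _ "{}"] exI[of _ 1])

text \<open>A countable cofinal family in \<open>B11\<close>. The shift \<open>Suc j\<close> keeps
  the threshold positive at \<open>j = 0\<close>, where the region is empty.\<close>

definition score_region :: "nat \<Rightarrow> ('a::euclidean_space \<times> real) set" where
  "score_region j = ball 0 (real j) \<times> {inverse (real (Suc j))<..}"

lemma score_region_in_B11: "score_region j \<in> B11"
proof -
  have "score_region j \<in> sets pos_score_borel"
    unfolding sets_pos_score_borel_iff score_region_def pos_score_space_def
    by (auto intro!: borel_open open_Times intro: less_trans[rotated])
  then show ?thesis
    unfolding B11_def score_region_def
    by (auto intro!: exI[of _ "ball 0 (real j)"] exI[of _ "inverse (1 + real j)"])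
qed

lemma B11_subset_score_region:
  assumes "A \<in> B11"
  obtains j where "A \<subseteq> score_region j"
proof -
  obtain B \<epsilon> where A: "bounded B" "\<epsilon> > 0" "A \<subseteq> B \<times> {\<epsilon><..}"
    using assms by (auto simp: B11_def)
  obtain R where R: "B \<subseteq> ball 0 R" using bounded_subset_ballD[OF A(1), of 0] by auto
  obtain n where n: "R < real n" using reals_Archimedean2 by blast
  obtain l where l: "inverse (real (Suc l)) < \<epsilon>" using reals_Archimedean[OF A(2)] by auto
  have "inverse (real (Suc (max n l))) \<le> inverse (real (Suc l))"
    by (intro le_imp_inverse_le) auto
  with l have "inverse (real (Suc (max n l))) < \<epsilon>" by linarith
  moreover have "ball (0::'a) R \<subseteq> ball 0 (real (max n l))"
    using n by (intro subset_ball) auto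
  ultimately have "B \<times> {\<epsilon><..} \<subseteq> score_region (max n l)"
    using R unfolding score_region_def by (intro Sigma_mono) auto
  then show ?thesis using A(3) that by blast
qed

lemma emeasure_configuration:
  assumes "\<mu> \<in> configurations" "A \<in> B11"
  obtains n :: nat where "emeasure \<mu> A = of_nat n"
proof -
  have "A \<in> sets pos_score_borel" using assms(2) by (simp add: B11_def)
  then have "emeasure \<mu> A \<in> insert \<infinity> (range of_nat)" "emeasure \<mu> A < \<infinity>"
    using assms by (auto simp: configurations_def counting_measure_def)
  then show ?thesis using that by auto
qed

lemma sets_configuration: "\<mu> \<in> configurations \<Longrightarrow> sets \<mu> = sets pos_score_borel"
  by (simp add: configurations_def counting_measure_def)

text \<open>Counts are prescribed exactly on sets that need not be open, so a cylinder need not be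
  vaguely open. Contradictory or unattainable prescriptions are allowed and give the empty
  cylinder.\<close>

definition cylinder :: "(('a::euclidean_space \<times> real) set \<times> nat) set \<Rightarrow> ('a \<times> real) measure set" where
  "cylinder T = {\<nu> \<in> configurations. \<forall>(D, n)\<in>T. emeasure \<nu> D = of_nat n}"

lemma cylinder_Un: "cylinder (T \<union> T') = cylinder T \<inter> cylinder T'"
  by (auto simp: cylinder_def)

text \<open>The step function with values \<open>c i\<close> on \<open>D i\<close> is within
  \<open>\<delta>\<close> of \<open>f\<close> on \<open>A\<close> up to a \<open>\<nu>\<close>-null
  set, and both vanish off \<open>A\<close>, which has finite mass.\<close>

lemma integral_step_approx:
  fixes f :: "'a::euclidean_space \<times> real \<Rightarrow> real" and m :: nat
  assumes \<nu>: "\<nu> \<in> configurations" and fm: "f \<in> borel_measurable pos_score_borel"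
    and A: "A \<in> B11" "\<And>x. x \<in> pos_score_space - A \<Longrightarrow> f x = 0"
    and D: "disjoint_family_on D {..<m}" "\<And>i. i < m \<Longrightarrow> D i \<in> sets pos_score_borel"
      "\<And>i. i < m \<Longrightarrow> D i \<subseteq> A"
    and null: "emeasure \<nu> (A - (\<Union>i<m. D i)) = 0"
    and osc: "\<And>i x. i < m \<Longrightarrow> x \<in> D i \<Longrightarrow> \<bar>f x - c i\<bar> \<le> \<delta>"
  shows "\<bar>(\<integral>x. f x \<partial>\<nu>) - (\<Sum>i<m. c i * measure \<nu> (D i))\<bar> \<le> \<delta> * measure \<nu> A"
proof -
  define g where "g x = (\<Sum>i<m. c i * indicator (D i) x)" for x
  have sets: "sets \<nu> = sets pos_score_borel" by (rule sets_configuration[OF \<nu>])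
  have space: "space \<nu> = pos_score_space" using sets_eq_imp_space_eq[OF sets] by simp
  have Am: "A \<in> sets \<nu>" using A(1) by (simp add: sets B11_def)
  have Dm: "D i \<in> sets \<nu>" if "i < m" for i using D(2)[OF that] by (simp add: sets)
  have fin: "emeasure \<nu> C < \<infinity>" if "C \<in> sets \<nu>" "C \<subseteq> A" for C
  proof -
    have "C \<in> B11" by (rule B11_subset[OF _ that(2) A(1)]) (use that(1) sets in simp)
    then show ?thesis using \<nu> by (auto simp: configurations_def)
  qed
  have gi: "integrable \<nu> g"
    unfolding g_def using fin Dm D(3)
    by (intro Bochner_Integration.integrable_sum integrable_mult_right integrable_real_indicator) auto
  have Ai: "integrable \<nu> (\<lambda>x. \<delta> * indicator A x)"
    using fin[OF Am] Am by (intro integrable_mult_right integrable_real_indicator) auto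
  have ae: "AE x in \<nu>. x \<notin> A - (\<Union>i<m. D i)"
    by (rule AE_not_in) (use null Am Dm in \<open>auto simp: null_sets_def\<close>)
  have pt: "\<bar>f x - g x\<bar> \<le> \<delta> * indicator A x"
    if x: "x \<in> pos_score_space" "x \<notin> A - (\<Union>i<m. D i)" for x
  proof (cases "x \<in> A")
    case True
    then obtain i where i: "i < m" "x \<in> D i" using x by auto
    have "indicator (D l) x = (if l = i then 1 else 0 :: real)" if "l < m" for l
      using D(1) i that by (auto simp: disjoint_family_on_def indicator_def)
    then have "g x = (\<Sum>l<m. if l = i then c l else 0)"
      unfolding g_def by (intro sum.cong) auto
    then have "g x = c i" using i by simp
    then show ?thesis using osc[OF i] True by simp
  next
    case False
    then have "g x = 0" unfolding g_def using D(3) by (intro sum.neutral) (auto simp: indicator_def)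
    then show ?thesis using A(2)[of x] x False by simp
  qed
  have bound: "AE x in \<nu>. \<bar>f x - g x\<bar> \<le> \<delta> * indicator A x"
    by (rule AE_mp[OF ae AE_I2], intro impI, rule pt) (simp_all add: space)
  have fm': "f \<in> borel_measurable \<nu>"
    unfolding measurable_cong_sets[OF sets refl] by (rule fm)
  have di: "integrable \<nu> (\<lambda>x. f x - g x)"
  proof (rule Bochner_Integration.integrable_bound[OF Ai])
    show "AE x in \<nu>. norm (f x - g x) \<le> norm (\<delta> * indicator A x)"
      by (rule AE_mp[OF bound AE_I2]) (auto simp: real_norm_def)
  qed (use fm' gi in simp)
  have fi: "integrable \<nu> f"
    using Bochner_Integration.integrable_add[OF di gi] by simp
  have "(\<integral>x. g x \<partial>\<nu>) = (\<Sum>i<m. c i * measure \<nu> (D i))"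
    unfolding g_def using fin Dm D(3)
    by (subst Bochner_Integration.integral_sum)
      (auto intro!: integrable_mult_right integrable_real_indicator sum.cong)
  then have "\<bar>(\<integral>x. f x \<partial>\<nu>) - (\<Sum>i<m. c i * measure \<nu> (D i))\<bar> = \<bar>\<integral>x. f x - g x \<partial>\<nu>\<bar>"
    using fi gi by simp
  also have "\<dots> \<le> (\<integral>x. \<bar>f x - g x\<bar> \<partial>\<nu>)" by (rule integral_abs_bound)
  also have "\<dots> \<le> (\<integral>x. \<delta> * indicator A x \<partial>\<nu>)"
    using di Ai bound by (intro integral_mono_AE) auto
  also have "\<dots> = \<delta> * measure \<nu> A"
    using Am by simp
  finally show ?thesis .
qed

lemma topspace_vague_topology: "topspace vague_topology = configurations"
proof -
  \<comment> \<open>One test function suffices: with \<open>V = UNIV\<close> its subbasic set is all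
    of \<open>configurations\<close>.\<close>
  have "(\<lambda>_. 0) \<in> vague_test_functions"
    using empty_in_B11 by (auto simp: vague_test_functions_def image_constant_conv)
  then show ?thesis
    unfolding vague_topology_def topology_generated_by_topspace by auto
qed

text \<open>Subtracting finite unions allows an open cover to be made disjoint without leaving a
  countable family; the choice \<open>b = UNIV\<close> supplies the part not yet covered.\<close>

definition network_cells :: "('a::euclidean_space \<times> real) set set \<Rightarrow> ('a \<times> real) set set" where
  "network_cells \<B> = (\<lambda>(j, b, L). score_region j \<inter> (b - \<Union>L)) `
     (UNIV \<times> insert UNIV \<B> \<times> {L. finite L \<and> L \<subseteq> \<B>})"

lemma network_cells_in_B11:
  fixes \<B> :: "('a::euclidean_space \<times> real) set set"
  assumes "topological_basis \<B>"
  shows "network_cells \<B> \<subseteq> B11"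
proof -
  have "score_region j \<inter> (b - \<Union>L) \<in> B11" if "b \<in> insert UNIV \<B>" "finite L" "L \<subseteq> \<B>" for j b L
  proof (rule B11_subset[OF _ _ score_region_in_B11[of j]])
    have "open b" using that(1) topological_basis_open[OF assms] by auto
    moreover have "open (\<Union>L)"
      using that(3) topological_basis_open[OF assms] by (intro open_Union) auto
    moreover have "(score_region j :: ('a \<times> real) set) \<in> sets borel"
        "(score_region j :: ('a \<times> real) set) \<subseteq> pos_score_space"
      using score_region_in_B11[of j, where 'a = 'a] by (simp_all add: B11_def sets_pos_score_borel_iff)
    ultimately show "score_region j \<inter> (b - \<Union>L) \<in> sets pos_score_borel"
      unfolding sets_pos_score_borel_iff by auto
  qed auto
  then show ?thesis by (auto simp: network_cells_def)
qed

text \<open>Basic sets on which \<open>f\<close> oscillates little cover the space; made disjoint,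
  they cut the region carrying \<open>f\<close> into cells \<open>D i\<close>. The uncovered rest
  \<open>E m\<close> decreases to the empty set, and its \<open>\<mu>\<close>-mass, being an
  integer, is exactly 0 for some \<open>m\<close>. Prescribing no atom in that rest, the total count
  \<open>N\<close> and the counts on the \<open>m\<close> cells determines the integral up to
  \<open>\<delta> * N\<close>.\<close>

lemma vague_subbase_network:
  fixes f :: "'a::euclidean_space \<times> real \<Rightarrow> real"
  assumes \<B>: "topological_basis \<B>" "countable \<B>"
    and f: "f \<in> vague_test_functions" and V: "open V"
    and \<mu>: "\<mu> \<in> configurations" "(\<integral>x. f x \<partial>\<mu>) \<in> V"
  shows "\<exists>T. finite T \<and> T \<subseteq> network_cells \<B> \<times> UNIV \<and> \<mu> \<in> cylinder T \<and>
    cylinder T \<subseteq> {\<nu> \<in> configurations. (\<integral>x. f x \<partial>\<nu>) \<in> V}"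
proof -
  obtain e where e: "e > 0" "ball (\<integral>x. f x \<partial>\<mu>) e \<subseteq> V"
    using openE[OF V \<mu>(2)] by blast
  have cont: "continuous_on pos_score_space f" using f by (simp add: vague_test_functions_def)
  obtain A where A: "A \<in> B11" "pos_score_space \<inter> closure {x \<in> pos_score_space. f x \<noteq> 0} \<subseteq> A"
    using f by (auto simp: vague_test_functions_def)
  obtain j where j: "A \<subseteq> score_region j" using B11_subset_score_region[OF A(1)] .
  define Rg :: "('a \<times> real) set" where "Rg = score_region j"
  have Rg: "Rg \<in> B11" unfolding Rg_def by (rule score_region_in_B11)
  have Rgp: "Rg \<subseteq> pos_score_space" using Rg by (simp add: B11_def sets_pos_score_borel_iff)
  have f0: "f x = 0" if "x \<in> pos_score_space - Rg" for x
  proof (rule ccontr)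
    assume "f x \<noteq> 0"
    then have "x \<in> pos_score_space \<inter> closure {x \<in> pos_score_space. f x \<noteq> 0}"
      using that by (auto intro!: subsetD[OF closure_subset])
    then show False using that A(2) j by (auto simp: Rg_def)
  qed
  obtain N where N: "emeasure \<mu> Rg = of_nat N" using emeasure_configuration[OF \<mu>(1) Rg] .
  \<comment> \<open>The integrals against \<open>\<mu>\<close> and \<open>\<nu>\<close> each deviate
    from a common sum by at most \<open>\<delta> * N\<close>, hence the 2; the 1 covers
    \<open>N = 0\<close>.\<close>
  define \<delta> where "\<delta> = e / (2 * (real N + 1))"
  have \<delta>: "\<delta> > 0" "2 * (\<delta> * real N) < e"
    using e(1) by (auto simp: \<delta>_def field_simps)
  define \<U> where "\<U> = {b \<in> \<B>. \<exists>c. \<forall>y\<in>b \<inter> pos_score_space. \<bar>f y - c\<bar> \<le> \<delta>}"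
  have cover: "\<exists>b\<in>\<U>. x \<in> b" if x: "x \<in> pos_score_space" for x
  proof -
    obtain d where d: "d > 0" "\<And>y. y \<in> pos_score_space \<Longrightarrow> dist y x < d \<Longrightarrow> dist (f y) (f x) < \<delta>"
      using cont x \<delta>(1) unfolding continuous_on_iff by metis
    obtain b where "b \<in> \<B>" "x \<in> b" "b \<subseteq> ball x d"
      using topological_basisE[OF \<B>(1) open_ball, of x x d] d(1) by (metis centre_in_ball)
    moreover have "\<bar>f y - f x\<bar> \<le> \<delta>" if "y \<in> b \<inter> pos_score_space" for y
      using d(2)[of y] that subsetD[OF calculation(3), of y] by (simp add: dist_real_def dist_commute)
    ultimately show ?thesis unfolding \<U>_def by blast
  qed
  have "(0, 1) \<in> pos_score_space" by (simp add: pos_score_space_def)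
  then have U_ne: "\<U> \<noteq> {}" using cover by blast
  have U_c: "countable \<U>" using \<B>(2) by (auto simp: \<U>_def intro: countable_subset[rotated])
  define b where "b = from_nat_into \<U>"
  have b_in: "b i \<in> \<U>" for i unfolding b_def by (rule from_nat_into[OF U_ne])
  have b_range: "range b = \<U>" unfolding b_def by (rule range_from_nat_into[OF U_ne U_c])
  have "\<forall>i. \<exists>c. \<forall>y\<in>b i \<inter> pos_score_space. \<bar>f y - c\<bar> \<le> \<delta>"
    using b_in by (auto simp: \<U>_def)
  then obtain c where c: "\<And>i y. y \<in> b i \<Longrightarrow> y \<in> pos_score_space \<Longrightarrow> \<bar>f y - c i\<bar> \<le> \<delta>"
    by (metis IntI)
  define E where "E m = Rg \<inter> (UNIV - \<Union>(b ` {..<m}))" for m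
  define D where "D i = Rg \<inter> (b i - \<Union>(b ` {..<i}))" for i
  have b_B: "b i \<in> \<B>" for i using b_in by (auto simp: \<U>_def)
  have cellI: "Rg \<inter> (s - \<Union>(b ` {..<i})) \<in> network_cells \<B>" if "s \<in> insert UNIV \<B>" for s i
    unfolding network_cells_def Rg_def
    by (rule image_eqI[of _ _ "(j, s, b ` {..<i})"]) (use that b_B in auto)
  have D_sub: "D i \<subseteq> Rg" for i unfolding D_def by blast
  have E_cell: "E m \<in> network_cells \<B>" for m unfolding E_def by (rule cellI) simp
  have D_cell: "D i \<in> network_cells \<B>" for i unfolding D_def by (rule cellI) (use b_B in simp)
  have Rg_cell: "Rg \<in> network_cells \<B>" using E_cell[of 0] by (simp add: E_def)
  have cellsB11: "C \<in> B11" if "C \<in> network_cells \<B>" for C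
    using network_cells_in_B11[OF \<B>(1)] that by blast
  have setsB11: "C \<in> sets pos_score_borel" if "C \<in> network_cells \<B>" for C
    using cellsB11[OF that] by (simp add: B11_def)
  have "\<exists>m. emeasure \<mu> (E m) = 0"
  proof -
    have "(\<lambda>m. emeasure \<mu> (E m)) \<longlonglongrightarrow> emeasure \<mu> (\<Inter>m. E m)"
    proof (rule Lim_emeasure_decseq)
      show "range E \<subseteq> sets \<mu>" using setsB11[OF E_cell] sets_configuration[OF \<mu>(1)] by auto
      show "decseq E" by (auto simp: decseq_def E_def intro: less_le_trans)
      show "emeasure \<mu> (E m) \<noteq> \<infinity>" for m
        using cellsB11[OF E_cell[of m]] \<mu>(1) by (auto simp: configurations_def)
    qed
    moreover have "(\<Inter>m. E m) = {}"
    proof -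
      have "\<exists>m. x \<notin> E m" for x
      proof (cases "x \<in> Rg")
        case True
        then obtain i where "x \<in> b i" using cover b_range Rgp by blast
        then show ?thesis by (auto simp: E_def intro!: exI[of _ "Suc i"])
      qed (auto simp: E_def)
      then show ?thesis by auto
    qed
    ultimately have "(\<lambda>m. emeasure \<mu> (E m)) \<longlonglongrightarrow> 0" by simp
    then have "eventually (\<lambda>m. emeasure \<mu> (E m) < 1) sequentially"
      by (rule order_tendstoD(2)) simp
    then obtain m where m: "emeasure \<mu> (E m) < 1"
      by (auto simp: eventually_sequentially)
    obtain n :: nat where n: "emeasure \<mu> (E m) = of_nat n"
      using emeasure_configuration[OF \<mu>(1) cellsB11[OF E_cell]] .
    have "n = 0"
    proof (rule ccontr)
      assume "n \<noteq> 0"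
      then have "(1::ennreal) \<le> of_nat n" by (cases n) auto
      with m n show False by simp
    qed
    then show ?thesis using n by auto
  qed
  then obtain m where m: "emeasure \<mu> (E m) = 0" ..
  have "\<forall>i. \<exists>n::nat. emeasure \<mu> (D i) = of_nat n"
    using emeasure_configuration[OF \<mu>(1) cellsB11[OF D_cell]] by metis
  then obtain n :: "nat \<Rightarrow> nat" where n: "\<And>i. emeasure \<mu> (D i) = of_nat (n i)" by metis
  define T where "T = {(Rg, N), (E m, 0)} \<union> (\<lambda>i. (D i, n i)) ` {..<m}"
  have "\<mu> \<in> cylinder T" using \<mu>(1) N m n by (auto simp: cylinder_def T_def)
  have approx: "\<bar>(\<integral>x. f x \<partial>\<nu>) - (\<Sum>i<m. c i * real (n i))\<bar> \<le> \<delta> * real N" if "\<nu> \<in> cylinder T" for \<nu>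
  proof -
    have \<nu>: "\<nu> \<in> configurations" "emeasure \<nu> Rg = of_nat N" "emeasure \<nu> (E m) = 0"
      "\<And>i. i < m \<Longrightarrow> emeasure \<nu> (D i) = of_nat (n i)"
      using that by (auto simp: cylinder_def T_def)
    have "Rg - (\<Union>i<m. D i) = E m"
    proof -
      have "x \<in> (\<Union>i<m. D i)" if "x \<in> Rg" "i < m" "x \<in> b i" for x i
      proof -
        \<comment> \<open>The cell containing \<open>x\<close> belongs to the first basic set that
          contains it.\<close>
        define l where "l = (LEAST l. x \<in> b l)"
        have "x \<in> b l" unfolding l_def by (rule LeastI) fact
        moreover have "l \<le> i" unfolding l_def by (rule Least_le) fact
        moreover have "x \<notin> b l'" if "l' < l" for l'
          using not_less_Least that unfolding l_def by blast
        ultimately show ?thesis using that by (auto simp: D_def intro!: bexI[of _ l])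
      qed
      then show ?thesis by (auto simp: E_def D_def)
    qed
    then have "emeasure \<nu> (Rg - (\<Union>i<m. D i)) = 0" using \<nu>(3) by simp
    moreover have "disjoint_family_on D {..<m}"
      unfolding disjoint_family_on_def
    proof safe
      fix i l x assume "i \<noteq> l" and x: "x \<in> D i" "x \<in> D l"
      then consider "i < l" | "l < i" by linarith
      then show "x \<in> {}" using x by cases (auto simp: D_def)
    qed
    moreover have "f \<in> borel_measurable pos_score_borel"
      unfolding pos_score_borel_def by (rule borel_measurable_continuous_on_restrict[OF cont])
    moreover have "\<bar>f x - c i\<bar> \<le> \<delta>" if "x \<in> D i" for i x
      using c[of x i] that Rgp by (auto simp: D_def)
    ultimately have "\<bar>(\<integral>x. f x \<partial>\<nu>) - (\<Sum>i<m. c i * measure \<nu> (D i))\<bar> \<le> \<delta> * measure \<nu> Rg"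
      using \<nu>(1) Rg f0 setsB11[OF D_cell] D_sub by (intro integral_step_approx) auto
    moreover have "measure \<nu> Rg = real N" using \<nu>(2) by (simp add: measure_def)
    moreover have "(\<Sum>i<m. c i * measure \<nu> (D i)) = (\<Sum>i<m. c i * real (n i))"
      using \<nu>(4) by (intro sum.cong) (auto simp: measure_def)
    ultimately show ?thesis by simp
  qed
  have "cylinder T \<subseteq> {\<nu> \<in> configurations. (\<integral>x. f x \<partial>\<nu>) \<in> V}"
  proof
    fix \<nu> assume \<nu>: "\<nu> \<in> cylinder T"
    have "\<bar>(\<integral>x. f x \<partial>\<mu>) - (\<integral>x. f x \<partial>\<nu>)\<bar> < e"
      using approx[OF \<nu>] approx[OF \<open>\<mu> \<in> cylinder T\<close>] \<delta>(2) by linarith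
    then have "(\<integral>x. f x \<partial>\<nu>) \<in> V" using e(2) by (auto simp: dist_real_def)
    then show "\<nu> \<in> {\<nu> \<in> configurations. (\<integral>x. f x \<partial>\<nu>) \<in> V}"
      using \<nu> by (simp add: cylinder_def)
  qed
  moreover have "finite T" "T \<subseteq> network_cells \<B> \<times> UNIV"
    using Rg_cell E_cell D_cell by (auto simp: T_def)
  ultimately show ?thesis using \<open>\<mu> \<in> cylinder T\<close> by blast
qed

text \<open>Cylinders over cells form a network. The induction follows the generation of the
  topology: an intersection joins the two finite sets of prescribed counts, a union keeps those of
  one member.\<close>

lemma vague_open_network:
  fixes W :: "('a::euclidean_space \<times> real) measure set"
  assumes \<B>: "topological_basis \<B>" "countable \<B>" and W: "openin vague_topology W" and \<mu>: "\<mu> \<in> W"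
  shows "\<exists>T. finite T \<and> T \<subseteq> network_cells \<B> \<times> UNIV \<and> \<mu> \<in> cylinder T \<and> cylinder T \<subseteq> W"
proof -
  have "generate_topology_on {{\<mu> \<in> configurations. (\<integral>x. f x \<partial>\<mu>) \<in> V} |
      (f :: 'a \<times> real \<Rightarrow> real) V. f \<in> vague_test_functions \<and> open V} W"
    using W unfolding vague_topology_def by (rule openin_topology_generated_by)
  then show ?thesis using \<mu>
  proof (induction arbitrary: \<mu>)
    case (Int a b)
    then have "\<mu> \<in> a" "\<mu> \<in> b" by auto
    obtain T where "finite T" "T \<subseteq> network_cells \<B> \<times> UNIV" "\<mu> \<in> cylinder T" "cylinder T \<subseteq> a"
      using Int.IH(1)[OF \<open>\<mu> \<in> a\<close>] by auto
    moreover obtain T' where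
      "finite T'" "T' \<subseteq> network_cells \<B> \<times> UNIV" "\<mu> \<in> cylinder T'" "cylinder T' \<subseteq> b"
      using Int.IH(2)[OF \<open>\<mu> \<in> b\<close>] by auto
    ultimately show ?case
      by (intro exI[of _ "T \<union> T'"]) (auto simp: cylinder_Un)
  next
    case (UN K)
    then obtain a where a: "a \<in> K" "\<mu> \<in> a" by auto
    obtain T where "finite T" "T \<subseteq> network_cells \<B> \<times> UNIV" "\<mu> \<in> cylinder T" "cylinder T \<subseteq> a"
      using UN.IH[OF a] by auto
    then show ?case using a(1) by (intro exI[of _ T]) auto
  next
    case (Basis s)
    then show ?case using vague_subbase_network[OF \<B>] by auto
  qed simp
qed

text \<open>Pairs of a cell and a count form a countable set, which has only countably many finite
  subsets; so the union of all such cylinders inside \<open>W\<close> is a countable one.\<close>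

lemma vague_open_eq_Union_cylinders:
  fixes W :: "('a::euclidean_space \<times> real) measure set"
  assumes W: "openin vague_topology W"
  shows "\<exists>T :: nat \<Rightarrow> (('a \<times> real) set \<times> nat) set.
    (\<forall>i. finite (T i) \<and> T i \<subseteq> B11 \<times> UNIV) \<and> W = (\<Union>i. cylinder (T i))"
proof -
  obtain \<B> :: "('a \<times> real) set set" where \<B>: "countable \<B>" "topological_basis \<B>"
    using ex_countable_basis by blast
  define \<T> where "\<T> = {T. finite T \<and> T \<subseteq> network_cells \<B> \<times> (UNIV :: nat set) \<and> cylinder T \<subseteq> W}"
  have "countable (network_cells \<B> \<times> (UNIV :: nat set))"
    unfolding network_cells_def
    using \<B>(1) countable_Collect_finite_subset[OF \<B>(1)]
    by (intro countable_SIGMA countable_image) auto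
  then have \<T>_c: "countable \<T>"
    by (rule countable_subset[OF _ countable_Collect_finite_subset, rotated]) (auto simp: \<T>_def)
  have "W = (\<Union>T\<in>\<T>. cylinder T)"
    using vague_open_network[OF \<B>(2,1) W] by (fastforce simp: \<T>_def)
  \<comment> \<open>Enumeration by \<open>from_nat_into\<close> requires a nonempty family, even for
    \<open>W = {}\<close>. Mass 1 on the empty set is impossible, so this cylinder is empty;
    \<open>{}\<close> is a cell because \<open>score_region 0\<close> is empty.\<close>
  moreover have "{({}, 1)} \<in> \<T>"
    by (auto simp: \<T>_def cylinder_def network_cells_def intro!: image_eqI[of _ _ "(0, UNIV, {})"] simp: score_region_def)
  then have "\<T> \<noteq> {}" by blast
  ultimately have W_eq: "W = (\<Union>i. cylinder (from_nat_into \<T> i))"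
    using arg_cong[OF range_from_nat_into[OF \<open>\<T> \<noteq> {}\<close> \<T>_c], of "\<lambda>X. \<Union>(cylinder ` X)"]
    by (simp only: image_image)
  show ?thesis
  proof (intro exI[of _ "from_nat_into \<T>"] conjI allI)
    fix i
    have "from_nat_into \<T> i \<in> \<T>" by (rule from_nat_into) fact
    then have *: "finite (from_nat_into \<T> i)" "from_nat_into \<T> i \<subseteq> network_cells \<B> \<times> UNIV"
      by (simp_all add: \<T>_def)
    show "finite (from_nat_into \<T> i)" by fact
    show "from_nat_into \<T> i \<subseteq> B11 \<times> UNIV"
      by (rule order_trans[OF *(2)]) (intro Sigma_mono network_cells_in_B11[OF \<B>(2)] order_refl)
  qed fact
qed

section \<open>Measurability with respect to the vague Borel sets\<close>

lemma cylinder_event: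
  assumes T: "finite T" "T \<subseteq> B11 \<times> UNIV"
    and f: "\<And>x. x \<in> space N \<Longrightarrow> f x \<in> configurations"
    and meas: "\<And>A. A \<in> B11 \<Longrightarrow> (\<lambda>x. emeasure (f x) A) \<in> borel_measurable N"
  shows "{x \<in> space N. f x \<in> cylinder T} \<in> sets N"
proof -
  have "{x \<in> space N. f x \<in> cylinder T}
      = {x \<in> space N. \<forall>p\<in>T. emeasure (f x) (fst p) = of_nat (snd p)}"
    using f by (auto simp: cylinder_def)
  also have "\<dots> \<in> sets N"
  proof (intro sets.sets_Collect_finite_All T(1))
    fix p assume "p \<in> T"
    then have "fst p \<in> B11" using T(2) by auto
    note meas[OF this, measurable]
    show "{x \<in> space N. emeasure (f x) (fst p) = of_nat (snd p)} \<in> sets N" by measurable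
  qed
  finally show ?thesis .
qed

text \<open>The preimage of any open set is a countable union of cylinder events, so measurable
  counts on \<open>B11\<close> suffice.\<close>

lemma measurable_vagueI:
  fixes f :: "'b \<Rightarrow> ('a::euclidean_space \<times> real) measure"
  assumes f: "\<And>x. x \<in> space N \<Longrightarrow> f x \<in> configurations"
    and meas: "\<And>A. A \<in> B11 \<Longrightarrow> (\<lambda>x. emeasure (f x) A) \<in> borel_measurable N"
  shows "f \<in> measurable N (borel_of_topology vague_topology)"
  unfolding borel_of_topology_def topspace_vague_topology
proof (rule measurable_measure_of)
  fix W :: "('a \<times> real) measure set" assume "W \<in> {V. openin vague_topology V}"
  then have "openin vague_topology W" by simp
  from vague_open_eq_Union_cylinders[OF this] obtain T where
    T': "\<forall>i. finite (T i) \<and> T i \<subseteq> B11 \<times> UNIV" and W: "W = (\<Union>i::nat. cylinder (T i))"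
    by (elim exE conjE) (rule that)
  have T: "finite (T i)" "T i \<subseteq> B11 \<times> UNIV" for i using T' by simp_all
  have "f -` W \<inter> space N = (\<Union>i. {x \<in> space N. f x \<in> cylinder (T i)})"
    using W by auto
  also have "\<dots> \<in> sets N"
    using cylinder_event[OF T(1,2) f meas] by (intro sets.countable_UN) auto
  finally show "f -` W \<inter> space N \<in> sets N" .
next
  show "{V. openin vague_topology V} \<subseteq> Pow (configurations :: ('a \<times> real) measure set)"
    using openin_subset topspace_vague_topology by fastforce
qed (use f in auto)

lemma vague_open_in_sets:
  assumes "openin vague_topology W"
  shows "W \<in> sets (borel_of_topology vague_topology)"
  unfolding borel_of_topology_def
  using assms openin_subset[of vague_topology] by (subst sets_measure_of) auto

lemma measurable_knn_config:
  assumes "k \<ge> 1"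
  shows "knn_config k \<in> measurable point_sets (borel_of_topology vague_topology)"
  by (rule measurable_vagueI)
    (auto intro: knn_config_in_configurations measurable_emeasure_knn_config[OF assms])

section \<open>Rescaling and locality\<close>

text \<open>Only whether \<open>k\<close> points have been reached enters.
  \<open>knn_dist_local\<close> relies on this weak form, as its two counts may differ at large
  radii.\<close>

lemma knn_dist_cong:
  assumes "\<And>r. 0 \<le> r \<Longrightarrow> k \<le> card ((I - {t}) \<inter> cball t r) \<longleftrightarrow> k \<le> card ((J - {t}) \<inter> cball t r)"
  shows "knn_dist k t I = knn_dist k t J"
  unfolding knn_dist_def using assms by (intro arg_cong[of _ _ "\<lambda>S. Inf (ereal ` S)"]) auto

lemma knn_dist_scale:
  assumes "u > 0"
  shows "knn_dist k (u *\<^sub>R t) ((*\<^sub>R) u ` I) = ereal u * knn_dist k t I"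
proof -
  define S where "S = {r. 0 \<le> r \<and> k \<le> card ((I - {t}) \<inter> cball t r)}"
  have "((*\<^sub>R) u ` I - {u *\<^sub>R t}) \<inter> cball (u *\<^sub>R t) (u * r) = (*\<^sub>R) u ` ((I - {t}) \<inter> cball t r)" for r
  proof -
    have "dist (u *\<^sub>R t) (u *\<^sub>R x) \<le> u * r \<longleftrightarrow> dist t x \<le> r" for x
      using assms by (simp add: dist_norm flip: scaleR_diff_right)
    then show ?thesis using assms by auto
  qed
  then have card: "card (((*\<^sub>R) u ` I - {u *\<^sub>R t}) \<inter> cball (u *\<^sub>R t) (u * r)) = card ((I - {t}) \<inter> cball t r)" for r
    using assms by (simp add: card_image inj_on_def)
  have "{r. 0 \<le> r \<and> k \<le> card (((*\<^sub>R) u ` I - {u *\<^sub>R t}) \<inter> cball (u *\<^sub>R t) r)} = (\<lambda>r. u * r) ` S"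
  proof (intro equalityI subsetI)
    fix r assume r: "r \<in> {r. 0 \<le> r \<and> k \<le> card (((*\<^sub>R) u ` I - {u *\<^sub>R t}) \<inter> cball (u *\<^sub>R t) r)}"
    then have "r / u \<in> S" using assms card[of "r / u"] by (simp add: S_def)
    then show "r \<in> (\<lambda>r. u * r) ` S" using assms by (intro image_eqI[of _ _ "r / u"]) auto
  qed (use assms card in \<open>auto simp: S_def\<close>)
  then have "knn_dist k (u *\<^sub>R t) ((*\<^sub>R) u ` I) = (INF r\<in>S. ereal u * ereal r)"
    by (simp add: knn_dist_def image_image)
  also have "\<dots> = ereal u * (INF r\<in>S. ereal r)"
  proof (rule antisym)
    show "ereal u * (INF r\<in>S. ereal r) \<le> (INF r\<in>S. ereal u * ereal r)"
      using assms by (intro INF_greatest ereal_mult_left_mono INF_lower) auto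
    have "(INF r\<in>S. ereal u * ereal r) / ereal u \<le> (INF r\<in>S. ereal r)"
      using assms by (intro INF_greatest) (auto simp: ereal_divide_le_pos intro: INF_lower)
    then show "(INF r\<in>S. ereal u * ereal r) \<le> ereal u * (INF r\<in>S. ereal r)"
      using assms by (simp add: ereal_divide_le_pos)
  qed
  finally show ?thesis by (simp add: S_def knn_dist_def)
qed

lemma knn_points_scale:
  assumes "u > 0"
  shows "(\<lambda>(t, s). (u *\<^sub>R t, s / u)) ` knn_points k I = knn_points k ((*\<^sub>R) u ` I)"
proof -
  have s: "real_of_ereal (inverse (ereal u * x)) = real_of_ereal (inverse x) / u" for x
    using assms by (cases x) (auto simp: field_simps)
  let ?h = "\<lambda>(t, s). (u *\<^sub>R t, s / u)"
  have "?h ` (S \<inter> pos_score_space) = ?h ` S \<inter> pos_score_space" for S :: "('a \<times> real) set"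
    using assms by (force simp: pos_score_space_def zero_less_divide_iff intro: rev_image_eqI)
  then show ?thesis
    unfolding knn_points_def by (simp only: image_image prod.case knn_dist_scale[OF assms] s)
qed

text \<open>The score is an inverse length: when positions are multiplied by \<open>u\<close> and
  scores divided by \<open>u\<close>, the result is again a nearest-neighbour configuration. This is
  the origin of the scaling function \<open>inverse u\<close>.\<close>

lemma scaling_knn_config:
  assumes "u > 0"
  shows "scaling (inverse u) u (knn_config k I) = knn_config k ((*\<^sub>R) u ` I)"
  using knn_points_scale[OF assms, of k I]
  by (simp add: scaling_def knn_config_def atoms_config_measure[OF knn_points_subset])

text \<open>\<open>score_at\<close> returns 0 where there is no atom, and an atom is dropped only if
  its score is not positive; for \<open>u > 0\<close> both sides are then false.\<close>

lemma score_at_knn_config: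
  assumes "t \<in> I" "u > 0"
  shows "score_at (knn_config k I) t > u \<longleftrightarrow> real_of_ereal (inverse (knn_dist k t I)) > u"
proof -
  define s where "s = real_of_ereal (inverse (knn_dist k t I))"
  have "(t, s') \<in> atoms (knn_config k I) \<longleftrightarrow> s' = s \<and> s > 0" for s'
    using assms(1) unfolding knn_config_def atoms_config_measure[OF knn_points_subset]
    by (auto simp: knn_points_def pos_score_space_def s_def simp del: real_of_ereal_inverse)
  then show ?thesis
    using assms(2) unfolding s_def[symmetric] by (auto simp: score_at_def)
qed

lemma score_at_knn_config_gt_iff:
  assumes "I \<in> locally_finite_sets" "k \<ge> 1" "u > 0" "t \<in> I"
  shows "score_at (knn_config k I) t > u \<longleftrightarrow> k \<le> card ((I - {t}) \<inter> ball t (inverse u))"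
  unfolding score_at_knn_config[OF assms(4,3)] knn_score_gt_iff[OF assms(1-3)]
  by (rule knn_dist_less_iff[OF assms(1,2)])

section \<open>Locally finite sets and dependence on a bounded region\<close>

lemma insert_locally_finite: "I \<in> locally_finite_sets \<Longrightarrow> insert x I \<in> locally_finite_sets"
  by (auto simp: locally_finite_sets_def Int_insert_left)

lemma finite_locally_finite: "finite I \<Longrightarrow> I \<in> locally_finite_sets"
  by (auto simp: locally_finite_sets_def)

lemma subset_locally_finite: "I \<in> locally_finite_sets \<Longrightarrow> J \<subseteq> I \<Longrightarrow> J \<in> locally_finite_sets"
  unfolding locally_finite_sets_def by (auto intro: finite_subset[of "J \<inter> _" "I \<inter> _"])

lemma scaleR_locally_finite:
  fixes I :: "'a::real_normed_vector set"
  assumes "I \<in> locally_finite_sets"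
  shows "(*\<^sub>R) u ` I \<in> locally_finite_sets"
proof (cases "u = 0")
  case True
  have "(*\<^sub>R) u ` I \<subseteq> {0}" using True by auto
  then show ?thesis by (intro finite_locally_finite) (rule finite_subset, auto)
next
  case False
  have "finite ((*\<^sub>R) u ` I \<inter> B)" if "bounded B" for B
  proof -
    have "(*\<^sub>R) u ` I \<inter> B \<subseteq> (*\<^sub>R) u ` (I \<inter> (*\<^sub>R) (inverse u) ` B)"
      using False by (auto simp: image_iff intro!: bexI[of _ "u *\<^sub>R _"])
    moreover have "finite (I \<inter> (*\<^sub>R) (inverse u) ` B)"
      using assms bounded_scaling[OF that] by (rule finite_Int_bounded)
    ultimately show ?thesis using finite_subset by blast
  qed
  then show ?thesis by (simp add: locally_finite_sets_def)
qed

text \<open>Points of the unit ball are at most 2 apart, which gives the constant 3. For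
  \<open>r < 2\<close> the ball of radius \<open>r\<close> around \<open>t\<close> stays inside
  \<open>ball 0 3\<close>, so both sets agree in it; for \<open>r \<ge> 2\<close> it contains all
  \<open>k\<close> other points of \<open>I \<inter> ball 0 R\<close>, and both counts have reached
  \<open>k\<close>.\<close>

lemma knn_dist_local:
  assumes I: "I \<in> locally_finite_sets" and R: "R \<ge> 3"
    and W: "I \<inter> ball 0 R \<subseteq> cball 0 1" "card (I \<inter> ball 0 R) = Suc k" and t: "t \<in> I \<inter> ball 0 R"
  shows "knn_dist k t I = knn_dist k t (I \<inter> ball 0 R)"
proof (rule knn_dist_cong)
  fix r :: real
  have norm1: "norm x \<le> 1" if "x \<in> I" "norm x < R" for x using that W(1) by auto
  have nt: "norm t \<le> 1" using t norm1 by auto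
  have fin: "finite ((I - {t}) \<inter> cball t r)"
    using finite_Int_bounded[OF I bounded_cball, of t r] by (rule rev_finite_subset) auto
  show "k \<le> card ((I - {t}) \<inter> cball t r) \<longleftrightarrow> k \<le> card ((I \<inter> ball 0 R - {t}) \<inter> cball t r)"
  proof (cases "r < 2")
    case True
    have "norm x < R" if "dist t x \<le> r" for x
      using that nt True R norm_triangle_sub[of x t] by (simp add: dist_norm norm_minus_commute)
    then have "(I - {t}) \<inter> cball t r = (I \<inter> ball 0 R - {t}) \<inter> cball t r" by auto
    then show ?thesis by simp
  next
    case False
    have "dist t x \<le> r" if "x \<in> I" "norm x < R" for x
      using norm1[OF that] nt False norm_triangle_ineq4[of t x] by (simp add: dist_norm)
    then have "(I \<inter> ball 0 R - {t}) \<inter> cball t r = I \<inter> ball 0 R - {t}" by auto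
    then have k: "card ((I \<inter> ball 0 R - {t}) \<inter> cball t r) = k"
      using W(2) t by simp
    have "card ((I \<inter> ball 0 R - {t}) \<inter> cball t r) \<le> card ((I - {t}) \<inter> cball t r)"
      by (rule card_mono[OF fin]) auto
    then show ?thesis using k by simp
  qed
qed

text \<open>The regions in \<open>T\<close> lie over \<open>ball 0 R\<close>, so only atoms at
  positions there are counted, and their scores are local by \<open>knn_dist_local\<close>.\<close>

lemma knn_config_local:
  assumes I: "I \<in> locally_finite_sets" and R: "R \<ge> 3"
    and W: "I \<inter> ball 0 R \<subseteq> cball 0 1" "card (I \<inter> ball 0 R) = Suc k"
    and T: "T \<subseteq> B11 \<times> UNIV" "\<And>D n. (D, n) \<in> T \<Longrightarrow> D \<subseteq> ball 0 R \<times> UNIV"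
  shows "knn_config k I \<in> cylinder T \<longleftrightarrow> knn_config k (I \<inter> ball 0 R) \<in> cylinder T"
proof -
  have J: "I \<inter> ball 0 R \<in> locally_finite_sets" by (rule subset_locally_finite[OF I]) auto
  have "emeasure (knn_config k I) D = emeasure (knn_config k (I \<inter> ball 0 R)) D" if "(D, n) \<in> T" for D n
  proof -
    have D: "D \<in> sets pos_score_borel" using T(1) that by (auto simp: B11_def)
    have "I \<inter> ball 0 R \<inter> {t. (t, real_of_ereal (inverse (knn_dist k t I))) \<in> D} =
      I \<inter> ball 0 R \<inter> ball 0 R \<inter> {t. (t, real_of_ereal (inverse (knn_dist k t (I \<inter> ball 0 R)))) \<in> D}"
      using knn_dist_local[OF I R W] by auto
    then show ?thesis
      by (simp only: emeasure_knn_config[OF I D bounded_ball T(2)[OF that]]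
          emeasure_knn_config[OF J D bounded_ball T(2)[OF that]])
  qed
  then show ?thesis
    using knn_config_in_configurations[OF I] knn_config_in_configurations[OF J]
    by (auto simp: cylinder_def)
qed

lemma cylinder_base_bounded:
  fixes T :: "(('a::euclidean_space \<times> real) set \<times> nat) set"
  assumes "finite T" "T \<subseteq> B11 \<times> UNIV"
  obtains R where "R \<ge> r" "\<And>D n. (D, n) \<in> T \<Longrightarrow> D \<subseteq> ball 0 R \<times> UNIV"
proof -
  have "bounded (\<Union>p\<in>T. fst ` fst p)"
  proof (rule bounded_UN[OF assms(1)], rule ballI)
    fix p assume "p \<in> T"
    then have "fst p \<in> B11" using assms(2) by auto
    then obtain B \<epsilon> where "bounded B" "fst p \<subseteq> B \<times> {\<epsilon><..}" by (auto simp: B11_def)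
    then show "bounded (fst ` fst p)" by (auto elim!: bounded_subset)
  qed
  then obtain R where R: "(\<Union>p\<in>T. fst ` fst p) \<subseteq> ball 0 R"
    using bounded_subset_ballD[of _ 0] by blast
  show ?thesis
  proof (rule that[of "max r R"])
    fix D n assume "(D, n) \<in> T"
    then have "fst ` D \<subseteq> ball 0 R" using R by force
    then show "D \<subseteq> ball 0 (max r R) \<times> UNIV" by fastforce
  qed simp
qed

section \<open>Poisson processes\<close>

lemma sets_borel_scaleR_image:
  fixes B :: "'a::euclidean_space set"
  assumes "B \<in> sets borel" "u \<noteq> 0"
  shows "(*\<^sub>R) u ` B \<in> sets borel"
proof -
  have "(*\<^sub>R) u ` B = (\<lambda>x. inverse u *\<^sub>R x) -` B \<inter> space borel"
    using assms(2) by (auto simp: image_iff intro!: bexI[of _ "inverse u *\<^sub>R _"])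
  also have "\<dots> \<in> sets borel"
    by (rule measurable_sets[OF _ assms(1)]) simp
  finally show ?thesis .
qed

lemma measure_lborel_scaleR_image:
  fixes B :: "'a::euclidean_space set"
  assumes "B \<in> sets borel" "u > 0"
  shows "measure lborel ((*\<^sub>R) u ` B) = u ^ DIM('a) * measure lborel B"
proof -
  have "measure lebesgue ((*\<^sub>R) u ` B) = \<bar>u\<bar> ^ DIM('a) * measure lebesgue B"
    using measure_lebesgue_affine[of u 0 B] by simp
  then show ?thesis
    using assms sets_borel_scaleR_image[OF assms(1), of u] by simp
qed

lemma poisson_process_scale:
  fixes P :: "'w \<Rightarrow> 'a::euclidean_space set"
  assumes P: "homogeneous_poisson_process c M P" and u: "u > 0"
  shows "homogeneous_poisson_process (c * inverse u ^ DIM('a)) M (\<lambda>\<omega>. (*\<^sub>R) u ` P \<omega>)"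
proof -
  let ?S = "\<lambda>B. (*\<^sub>R) (inverse u) ` B"
  have P': "prob_space M" "\<And>\<omega> B. \<omega> \<in> space M \<Longrightarrow> bounded B \<Longrightarrow> finite (P \<omega> \<inter> B)"
    "\<And>B. B \<in> sets borel \<Longrightarrow> bounded B \<Longrightarrow> (\<lambda>\<omega>. card (P \<omega> \<inter> B)) \<in> measurable M (count_space UNIV)"
    "\<And>B n. B \<in> sets borel \<Longrightarrow> bounded B \<Longrightarrow> measure M {\<omega> \<in> space M. card (P \<omega> \<inter> B) = n} =
             (c * measure lborel B) ^ n / fact n * exp (- (c * measure lborel B))"
    "\<And>n B. (\<And>i. i < n \<Longrightarrow> B i \<in> sets borel \<and> bounded (B i)) \<Longrightarrow> disjoint_family_on B {..<n::nat} \<Longrightarrow>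
        prob_space.indep_vars M (\<lambda>_. count_space UNIV) (\<lambda>i \<omega>. card (P \<omega> \<inter> B i)) {..<n}"
    using P unfolding homogeneous_poisson_process_def by blast+
  have card: "card ((*\<^sub>R) u ` P \<omega> \<inter> B) = card (P \<omega> \<inter> ?S B)" for \<omega> B
  proof -
    have "(*\<^sub>R) u ` P \<omega> \<inter> B = (*\<^sub>R) u ` (P \<omega> \<inter> ?S B)"
      using u by (auto simp: image_iff intro!: bexI[of _ "u *\<^sub>R _"])
    then show ?thesis using u by (simp add: card_image inj_on_def)
  qed
  have S: "?S B \<in> sets borel" "bounded (?S B)" if "B \<in> sets borel" "bounded B" for B :: "'a set"
    using that u by (auto intro: sets_borel_scaleR_image bounded_scaling)
  have lf: "finite ((*\<^sub>R) u ` P \<omega> \<inter> B)" if "\<omega> \<in> space M" "bounded B" for \<omega> B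
    using scaleR_locally_finite[of "P \<omega>" u] P'(2)[OF that(1)] that(2)
    by (simp add: locally_finite_sets_def)
  have vol: "c * measure lborel (?S B) = c * inverse u ^ DIM('a) * measure lborel B"
    if "B \<in> sets borel" for B :: "'a set"
    using measure_lborel_scaleR_image[OF that, of "inverse u"] u by simp
  have disj: "disjoint_family_on (\<lambda>i. ?S (B i)) {..<n}" if "disjoint_family_on B {..<n}" for B :: "nat \<Rightarrow> 'a set" and n
    using that u by (fastforce simp: disjoint_family_on_def)
  show ?thesis
    unfolding homogeneous_poisson_process_def card
  proof (intro conjI allI impI ballI P'(1) lf P'(3) P'(5))
    fix B :: "'a set" and n assume "B \<in> sets borel" "bounded B"
    then show "measure M {\<omega> \<in> space M. card (P \<omega> \<inter> ?S B) = n} =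
      (c * inverse u ^ DIM('a) * measure lborel B) ^ n / fact n *
        exp (- (c * inverse u ^ DIM('a) * measure lborel B))"
      using P'(4)[OF S] vol by simp
  qed (use S disj in auto)
qed

lemma poisson_locally_finite:
  assumes "homogeneous_poisson_process c M P" "\<omega> \<in> space M"
  shows "P \<omega> \<in> locally_finite_sets"
  using assms by (simp add: homogeneous_poisson_process_def locally_finite_sets_def)

lemma poisson_measurable:
  assumes P: "homogeneous_poisson_process c M P"
  shows "P \<in> measurable M point_sets"
proof (rule measurable_point_setsI)
  fix B :: "'b set" assume B: "B \<in> sets borel" "bounded B"
  have "(\<lambda>\<omega>. card (P \<omega> \<inter> B)) \<in> measurable M (count_space UNIV)"
    using P B by (simp add: homogeneous_poisson_process_def)
  then have "{\<omega> \<in> space M. card (P \<omega> \<inter> B) = 0} \<in> sets M" by measurable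
  \<comment> \<open>\<open>card\<close> is 0 on infinite sets as well, so this relies on local
    finiteness.\<close>
  moreover have "{\<omega> \<in> space M. card (P \<omega> \<inter> B) = 0} = {\<omega> \<in> space M. P \<omega> \<inter> B = {}}"
    using finite_Int_bounded[OF poisson_locally_finite[OF P] B(2)] by auto
  ultimately show "{\<omega> \<in> space M. P \<omega> \<inter> B = {}} \<in> sets M" by simp
qed (rule poisson_locally_finite[OF P])

lemma poisson_card_eq:
  assumes "homogeneous_poisson_process c M P" "B \<in> sets borel" "bounded B"
  shows "measure M {\<omega> \<in> space M. card (P \<omega> \<inter> B) = n} =
    (c * measure lborel B) ^ n / fact n * exp (- (c * measure lborel B))"
  using assms by (simp add: homogeneous_poisson_process_def)

text \<open>Meant for a forbidden part of the unit ball, the rest of that ball, and the annulus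
  around it.\<close>

lemma poisson_indep3:
  assumes P: "homogeneous_poisson_process c M P"
    and B: "B0 \<in> sets borel" "bounded B0" "B1 \<in> sets borel" "bounded B1" "B2 \<in> sets borel" "bounded B2"
    and disj: "B0 \<inter> B1 = {}" "B0 \<inter> B2 = {}" "B1 \<inter> B2 = {}"
  shows "measure M {\<omega> \<in> space M. card (P \<omega> \<inter> B0) = n0 \<and> card (P \<omega> \<inter> B1) = n1 \<and> card (P \<omega> \<inter> B2) = n2} =
    measure M {\<omega> \<in> space M. card (P \<omega> \<inter> B0) = n0} * measure M {\<omega> \<in> space M. card (P \<omega> \<inter> B1) = n1} *
    measure M {\<omega> \<in> space M. card (P \<omega> \<inter> B2) = n2}"
proof -
  interpret prob_space M using P by (simp add: homogeneous_poisson_process_def)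
  define B where "B i = (if i = 0 then B0 else if i = 1 then B1 else B2)" for i :: nat
  define N where "N i = (if i = 0 then n0 else if i = 1 then n1 else n2)" for i :: nat
  have I3: "{..<3::nat} = {0, 1, 2}" by auto
  have "disjoint_family_on B {..<3}"
    using disj by (auto simp: disjoint_family_on_def B_def I3)
  moreover have "\<forall>i<3. B i \<in> sets borel \<and> bounded (B i)"
    using assms(2-7) by (simp add: B_def)
  moreover have "indep_vars (\<lambda>_. count_space UNIV) (\<lambda>i \<omega>. card (P \<omega> \<inter> B i)) {..<n}"
    if "(\<forall>i<n. B i \<in> sets borel \<and> bounded (B i)) \<and> disjoint_family_on B {..<n}" for n
    using P that unfolding homogeneous_poisson_process_def by blast
  ultimately have iv: "indep_vars (\<lambda>_. count_space UNIV) (\<lambda>i \<omega>. card (P \<omega> \<inter> B i)) {..<3}"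
    by blast
  have "prob (\<Inter>i\<in>{..<3}. (\<lambda>\<omega>. card (P \<omega> \<inter> B i)) -` {N i} \<inter> space M) =
      (\<Prod>i<3. prob ((\<lambda>\<omega>. card (P \<omega> \<inter> B i)) -` {N i} \<inter> space M))"
    by (rule indep_varsD_finite[OF iv]) (auto simp: I3)
  moreover have "(\<lambda>\<omega>. card (P \<omega> \<inter> C)) -` {n} \<inter> space M = {\<omega> \<in> space M. card (P \<omega> \<inter> C) = n}" for C n
    by auto
  moreover have "{\<omega> \<in> space M. card (P \<omega> \<inter> B0) = n0} \<inter> ({\<omega> \<in> space M. card (P \<omega> \<inter> B1) = n1} \<inter>
      {\<omega> \<in> space M. card (P \<omega> \<inter> B2) = n2}) =
    {\<omega> \<in> space M. card (P \<omega> \<inter> B0) = n0 \<and> card (P \<omega> \<inter> B1) = n1 \<and> card (P \<omega> \<inter> B2) = n2}"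
    by auto
  ultimately show ?thesis by (simp add: I3 B_def N_def mult.assoc)
qed

text \<open>Since \<open>(j + k)! \<ge> j! k!\<close>, the factor \<open>l^k / k!\<close> can be
  taken out of the tail, and what remains sums to \<open>exp (- l) * exp l = 1\<close>.\<close>

lemma poisson_tail_bound:
  assumes P: "homogeneous_poisson_process c M P" and c: "c \<ge> 0"
    and B: "B \<in> sets borel" "bounded B"
  shows "measure M {\<omega> \<in> space M. k \<le> card (P \<omega> \<inter> B)} \<le> (c * measure lborel B) ^ k / fact k"
proof -
  interpret prob_space M using P by (simp add: homogeneous_poisson_process_def)
  define l where "l = c * measure lborel B"
  have l: "l \<ge> 0" using c by (simp add: l_def)
  have [measurable]: "(\<lambda>\<omega>. card (P \<omega> \<inter> B)) \<in> measurable M (count_space UNIV)"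
    using P B by (simp add: homogeneous_poisson_process_def)
  define A where "A j = {\<omega> \<in> space M. card (P \<omega> \<inter> B) = j + k}" for j
  have "range A \<subseteq> sets M" unfolding A_def by auto
  moreover have "disjoint_family A" by (auto simp: disjoint_family_on_def A_def)
  ultimately have "(\<lambda>j. prob (A j)) sums prob (\<Union>j. A j)" by (rule finite_measure_UNION)
  moreover have "(\<Union>j. A j) = {\<omega> \<in> space M. k \<le> card (P \<omega> \<inter> B)}"
    by (auto simp: A_def) (metis le_add_diff_inverse2)
  ultimately have s1: "(\<lambda>j. prob (A j)) sums prob {\<omega> \<in> space M. k \<le> card (P \<omega> \<inter> B)}" by simp
  have "(\<lambda>j. l ^ k / fact k * exp (- l) * (l ^ j /\<^sub>R fact j)) sums (l ^ k / fact k * exp (- l) * exp l)"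
    by (intro sums_mult exp_converges)
  then have s2: "(\<lambda>j. l ^ k / fact k * exp (- l) * (l ^ j / fact j)) sums (l ^ k / fact k)"
    by (simp add: exp_minus field_simps)
  have "prob (A j) \<le> l ^ k / fact k * exp (- l) * (l ^ j / fact j)" for j
  proof -
    have "(fact k * fact j :: nat) \<le> fact (k + j)"
      by (rule dvd_imp_le[OF fact_fact_dvd_fact]) simp
    then have "real (fact k * fact j) \<le> real (fact (k + j))"
      by (simp only: of_nat_le_iff)
    then have "(fact k * fact j :: real) \<le> fact (j + k)"
      by (simp add: add.commute)
    then have "l ^ (j + k) / fact (j + k) \<le> l ^ (j + k) / (fact k * fact j)"
      using l by (intro divide_left_mono) auto
    then have "l ^ (j + k) / fact (j + k) * exp (- l) \<le> l ^ (j + k) / (fact k * fact j) * exp (- l)"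
      by (rule mult_right_mono) simp
    then show ?thesis
      unfolding A_def poisson_card_eq[OF P B] l_def[symmetric] by (simp add: power_add field_simps)
  qed
  then show ?thesis
    using sums_le[OF _ s1 s2] by (simp add: l_def)
qed

section \<open>Weak convergence from lower bounds on open sets\<close>

text \<open>The natural numbers strictly below \<open>x\<close> are as many as the ceiling of
  \<open>x\<close>, and \<open>x \<le> n\<close> ensures that the cut-off \<open>l < n\<close>
  removes none of them.\<close>

lemma count_nat_less_real:
  assumes "0 \<le> x" "x \<le> real n"
  shows "x \<le> real (card {l. l < n \<and> real l < x})" "real (card {l. l < n \<and> real l < x}) \<le> x + 1"
proof -
  have "{l. l < n \<and> real l < x} = {..<nat \<lceil>x\<rceil>}"
    using assms(2) by (auto simp: zless_nat_eq_int_zless less_ceiling_iff)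
  then have "card {l. l < n \<and> real l < x} = nat \<lceil>x\<rceil>" by simp
  then have "real (card {l. l < n \<and> real l < x}) = of_int \<lceil>x\<rceil>" using assms(1) by simp
  then show "x \<le> real (card {l. l < n \<and> real l < x})" "real (card {l. l < n \<and> real l < x}) \<le> x + 1"
    by linarith+
qed

text \<open>Pointwise, \<open>n * F x\<close> differs by at most 1 from the number of levels
  \<open>l / n\<close> strictly below \<open>F x\<close>. Strict levels make the superlevel sets of
  a continuous \<open>F\<close> open.\<close>

lemma (in prob_space) layer_cake_bounds:
  fixes F :: "'a \<Rightarrow> real"
  assumes [measurable]: "F \<in> borel_measurable M" and F: "\<And>x. x \<in> space M \<Longrightarrow> 0 \<le> F x \<and> F x \<le> 1"
    and n: "n > 0"
  shows "expectation F \<le> (\<Sum>l<n. prob {x \<in> space M. F x > real l / real n}) / real n"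
    and "(\<Sum>l<n. prob {x \<in> space M. F x > real l / real n}) / real n \<le> expectation F + 1 / real n"
proof -
  define G where "G x = (\<Sum>l<n. indicator {x \<in> space M. F x > real l / real n} x) / real n" for x
  have Fi: "integrable M F"
    by (rule integrable_const_bound[of _ 1]) (use F in \<open>auto intro!: AE_I2\<close>)
  have Gi: "integrable M G"
    unfolding G_def
    by (intro integrable_divide_zero Bochner_Integration.integrable_sum integrable_real_indicator)
      (auto simp: emeasure_eq_measure)
  have EG: "expectation G = (\<Sum>l<n. prob {x \<in> space M. F x > real l / real n}) / real n"
    unfolding G_def
    by (subst integral_divide_zero, subst Bochner_Integration.integral_sum)
      (auto intro!: integrable_real_indicator simp: emeasure_eq_measure)
  have G: "F x \<le> G x \<and> G x \<le> F x + 1 / real n" if x: "x \<in> space M" for x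
  proof -
    have "(\<Sum>l<n. indicator {x \<in> space M. F x > real l / real n} x :: real)
        = (\<Sum>l<n. if real l < F x * real n then 1 else 0)"
      using x n by (intro sum.cong) (auto simp: field_simps)
    also have "\<dots> = real (card {l. l < n \<and> real l < F x * real n})"
      by (simp add: sum.If_cases lessThan_def Collect_conj_eq)
    finally have eq: "G x * real n = real (card {l. l < n \<and> real l < F x * real n})"
      using n by (simp add: G_def)
    have "0 \<le> F x * real n" "F x * real n \<le> real n"
      using F[OF x] n by (auto intro: mult_left_le_one_le)
    from count_nat_less_real[OF this] show ?thesis
      unfolding eq[symmetric] using n by (simp_all add: field_simps)
  qed
  show "expectation F \<le> (\<Sum>l<n. prob {x \<in> space M. F x > real l / real n}) / real n"
    unfolding EG[symmetric] by (rule integral_mono[OF Fi Gi]) (use G in auto)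
  have "expectation G \<le> expectation (\<lambda>x. F x + 1 / real n)"
    by (rule integral_mono[OF Gi]) (use G Fi in auto)
  also have "\<dots> = expectation F + 1 / real n"
    using Fi by (simp add: prob_space)
  finally show "(\<Sum>l<n. prob {x \<in> space M. F x > real l / real n}) / real n \<le> expectation F + 1 / real n"
    unfolding EG .
qed

lemma continuous_map_measurable:
  assumes "continuous_map T euclideanreal F"
  shows "F \<in> borel_measurable (borel_of_topology T)"
proof (rule borel_measurableI)
  fix S :: "real set" assume "open S"
  then have "openin T {x \<in> topspace T. F x \<in> S}"
    using assms by (intro openin_continuous_map_preimage) auto
  moreover have "F -` S \<inter> space (borel_of_topology T) = {x \<in> topspace T. F x \<in> S}"
    by (auto simp: borel_of_topology_def space_measure_of_conv)
  moreover have "{V. openin T V} \<subseteq> Pow (topspace T)" using openin_subset by auto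
  ultimately show "F -` S \<inter> space (borel_of_topology T) \<in> sets (borel_of_topology T)"
    by (simp add: borel_of_topology_def sets_measure_of)
qed

text \<open>Lower bounds on the masses of open sets suffice because the layer-cake sums of \<open>F\<close> and of
  \<open>- F\<close> only involve open superlevel sets.\<close>

lemma open_lower_bound_integral:
  fixes F :: "'b \<Rightarrow> real"
  assumes Q: "eventually (\<lambda>i. prob_space (Q i) \<and> sets (Q i) = sets (borel_of_topology T)) \<F>"
    and Q': "prob_space Q'" "sets Q' = sets (borel_of_topology T)"
    and lower: "\<And>W e. openin T W \<Longrightarrow> e > 0 \<Longrightarrow> eventually (\<lambda>i. measure Q' W - e \<le> measure (Q i) W) \<F>"
    and F: "continuous_map T euclideanreal F" "\<And>x. x \<in> topspace T \<Longrightarrow> 0 \<le> F x \<and> F x \<le> 1"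
    and e: "e > 0"
  shows "eventually (\<lambda>i. (\<integral>x. F x \<partial>Q') - e \<le> (\<integral>x. F x \<partial>Q i)) \<F>"
proof -
  \<comment> \<open>Half of \<open>e\<close> pays for the discretisation, the other half for the
    measures of the superlevel sets.\<close>
  obtain n :: nat where n: "n > 0" "1 / real n < e / 2"
  proof -
    obtain n where "inverse (real (Suc n)) < e / 2" using reals_Archimedean[of "e / 2"] e by auto
    then show ?thesis using that[of "Suc n"] by (simp add: inverse_eq_divide)
  qed
  have space: "space N = topspace T" if "sets N = sets (borel_of_topology T)" for N :: "'b measure"
    using sets_eq_imp_space_eq[OF that] by (simp add: borel_of_topology_def space_measure_of_conv)
  define W where "W l = {x \<in> topspace T. F x > real l / real n}" for l
  have W: "openin T (W l)" for l
    using openin_continuous_map_preimage[OF F(1), of "{real l / real n<..}"] by (simp add: W_def)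
  have ev: "eventually (\<lambda>i. \<forall>l\<in>{..<n}. measure Q' (W l) - e / 2 \<le> measure (Q i) (W l)) \<F>"
    using lower[OF W] e by (intro eventually_ball_finite) auto
  have bounds: "(\<integral>x. F x \<partial>N) \<le> (\<Sum>l<n. measure N (W l)) / real n"
      "(\<Sum>l<n. measure N (W l)) / real n \<le> (\<integral>x. F x \<partial>N) + 1 / real n"
    if N: "prob_space N" "sets N = sets (borel_of_topology T)" for N
  proof -
    interpret prob_space N by fact
    have m: "F \<in> borel_measurable N"
      unfolding measurable_cong_sets[OF N(2) refl] by (rule continuous_map_measurable[OF F(1)])
    have b: "\<And>x. x \<in> space N \<Longrightarrow> 0 \<le> F x \<and> F x \<le> 1" using F(2) by (simp add: space[OF N(2)])
    note layer_cake_bounds[OF m b n(1), unfolded space[OF N(2)]]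
    then show "(\<integral>x. F x \<partial>N) \<le> (\<Sum>l<n. measure N (W l)) / real n"
      "(\<Sum>l<n. measure N (W l)) / real n \<le> (\<integral>x. F x \<partial>N) + 1 / real n"
      by (simp_all add: W_def)
  qed
  from ev Q show ?thesis
  proof eventually_elim
    case (elim i)
    have "(\<Sum>l<n. measure Q' (W l)) - real n * (e / 2) = (\<Sum>l<n. measure Q' (W l) - e / 2)"
      by (simp add: sum_subtractf)
    also have "\<dots> \<le> (\<Sum>l<n. measure (Q i) (W l))"
      using elim(1) by (intro sum_mono) auto
    finally have "((\<Sum>l<n. measure Q' (W l)) - real n * (e / 2)) / real n \<le> (\<Sum>l<n. measure (Q i) (W l)) / real n"
      by (rule divide_right_mono) simp
    moreover have "((\<Sum>l<n. measure Q' (W l)) - real n * (e / 2)) / real n = (\<Sum>l<n. measure Q' (W l)) / real n - e / 2"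
      using n(1) by (simp add: diff_divide_distrib)
    ultimately show ?case
      using bounds(1)[OF Q'] bounds(2)[of "Q i"] elim(2) n(2) by linarith
  qed
qed

lemma weakly_convergesI_open:
  assumes Q: "eventually (\<lambda>i. prob_space (Q i) \<and> sets (Q i) = sets (borel_of_topology T)) \<F>"
    and Q': "prob_space Q'" "sets Q' = sets (borel_of_topology T)"
    and lower: "\<And>W e. openin T W \<Longrightarrow> e > 0 \<Longrightarrow> eventually (\<lambda>i. measure Q' W - e \<le> measure (Q i) W) \<F>"
  shows "weakly_converges T Q Q' \<F>"
  unfolding weakly_converges_def
proof (intro allI impI)
  fix F assume "continuous_map T euclideanreal F \<and> bounded (F ` topspace T)"
  then have F: "continuous_map T euclideanreal F" "bounded (F ` topspace T)" by auto
  obtain b where b: "b > 0" "\<And>x. x \<in> topspace T \<Longrightarrow> \<bar>F x\<bar> \<le> b"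
    using F(2) by (auto simp: bounded_pos)
  have lin: "(\<integral>x. (s * F x + b) / (2 * b) \<partial>N) = (s * (\<integral>x. F x \<partial>N) + b) / (2 * b)"
    if N: "prob_space N" "sets N = sets (borel_of_topology T)" for N s
  proof -
    interpret prob_space N by fact
    have m: "F \<in> borel_measurable N"
      unfolding measurable_cong_sets[OF N(2) refl] by (rule continuous_map_measurable[OF F(1)])
    have "space N = topspace T"
      using sets_eq_imp_space_eq[OF N(2)] by (simp add: borel_of_topology_def space_measure_of_conv)
    then have "integrable N F"
      using b m by (intro integrable_const_bound[of _ b]) (auto intro!: AE_I2)
    then show ?thesis by (simp add: prob_space)
  qed
  \<comment> \<open>The sign \<open>s\<close> treats \<open>F\<close> and \<open>- F\<close> at
    once; the affine map \<open>(s * F x + b) / (2 * b)\<close> brings their values into the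
    interval from 0 to 1.\<close>
  have half: "eventually (\<lambda>i. s * (\<integral>x. F x \<partial>Q') - e \<le> s * (\<integral>x. F x \<partial>Q i)) \<F>"
    if s: "s = 1 \<or> s = - 1" and e: "e > 0" for s e
  proof -
    have c: "continuous_map T euclideanreal (\<lambda>x. (s * F x + b) / (2 * b))"
      using b(1) by (intro continuous_map_real_divide continuous_map_add continuous_map_real_mult F(1)) auto
    have r: "0 \<le> (s * F x + b) / (2 * b) \<and> (s * F x + b) / (2 * b) \<le> 1" if "x \<in> topspace T" for x
      using b(2)[OF that] b(1) s by (auto simp: field_simps abs_le_iff)
    have "e / (2 * b) > 0" using e b(1) by simp
    have "eventually (\<lambda>i. (\<integral>x. (s * F x + b) / (2 * b) \<partial>Q') - e / (2 * b)
        \<le> (\<integral>x. (s * F x + b) / (2 * b) \<partial>Q i)) \<F>"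
      by (rule open_lower_bound_integral[OF Q Q' _ c]) (use lower r \<open>e / (2 * b) > 0\<close> in auto)
    from this Q show ?thesis
    proof eventually_elim
      case (elim i)
      then have "(s * (\<integral>x. F x \<partial>Q') + b) / (2 * b) - e / (2 * b) \<le> (s * (\<integral>x. F x \<partial>Q i) + b) / (2 * b)"
        by (simp only: lin[OF Q'] lin)
      then have "(s * (\<integral>x. F x \<partial>Q') + b - e) / (2 * b) \<le> (s * (\<integral>x. F x \<partial>Q i) + b) / (2 * b)"
        by (simp only: diff_divide_distrib)
      then show ?case using b(1) by (simp add: divide_le_cancel)
    qed
  qed
  show "((\<lambda>i. \<integral>x. F x \<partial>Q i) \<longlongrightarrow> (\<integral>x. F x \<partial>Q')) \<F>"
  proof (rule tendstoI)
    fix e :: real assume "e > 0"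
    then have e2: "e / 2 > 0" by simp
    from half[of 1, OF _ e2] half[of "- 1", OF _ e2]
    have "eventually (\<lambda>i. (\<integral>x. F x \<partial>Q') - e / 2 \<le> (\<integral>x. F x \<partial>Q i)) \<F>"
      "eventually (\<lambda>i. - (\<integral>x. F x \<partial>Q') - e / 2 \<le> - (\<integral>x. F x \<partial>Q i)) \<F>" by simp_all
    then show "eventually (\<lambda>i. dist (\<integral>x. F x \<partial>Q i) (\<integral>x. F x \<partial>Q') < e) \<F>"
      by eventually_elim (use \<open>e > 0\<close> in \<open>simp add: dist_real_def abs_less_iff\<close>)
  qed
qed

section \<open>Uniform points and the conditioned Poisson process\<close>

lemma measure_cball_pos: "0 < measure lborel (cball (0::'a::euclidean_space) 1)"
  by (simp add: content_cball_pos)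

lemma emeasure_cball_finite: "emeasure lborel (cball (0::'a::euclidean_space) 1) \<noteq> \<infinity>"
  using emeasure_lborel_cball_finite[of "0::'a" 1] by auto

lemma prob_uniform_cball:
  fixes X :: "'v \<Rightarrow> 'a::euclidean_space"
  assumes X: "X \<in> borel_measurable M" "distr M borel X = uniform_measure lborel (cball 0 1)"
    and B: "B \<in> sets borel"
  shows "measure M {\<omega> \<in> space M. X \<omega> \<in> B} =
    measure lborel (cball 0 1 \<inter> B) / measure lborel (cball (0::'a) 1)"
proof -
  have "measure M {\<omega> \<in> space M. X \<omega> \<in> B} = measure (distr M borel X) B"
    using X(1) B by (subst measure_distr) (auto intro!: arg_cong[of _ _ "measure M"])
  also have "\<dots> = measure lborel (cball 0 1 \<inter> B) / measure lborel (cball (0::'a) 1)"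
    unfolding X(2) using B measure_cball_pos[where 'a = 'a] emeasure_cball_finite[where 'a = 'a]
    by (intro measure_uniform_measure) (auto simp: measure_def)
  finally show ?thesis .
qed

text \<open>The sphere and the centre are null sets. The sphere must go because an exceedance counts
  points in the open ball, the centre because the origin is inserted as an additional point.\<close>

lemma (in prob_space) AE_uniform_cball:
  fixes X :: "'a \<Rightarrow> 'b::euclidean_space"
  assumes X: "X \<in> borel_measurable M" "distr M borel X = uniform_measure lborel (cball 0 1)"
  shows "AE \<omega> in M. X \<omega> \<in> ball 0 1 - {0}"
proof -
  have m: "sphere (0::'b) 1 \<union> {0} \<in> null_sets lborel"
    using negligible_sphere[of "0::'b" 1]
    by (intro null_sets.Un) (auto simp: negligible_iff_null_sets null_sets_completion_iff)
  have "prob {\<omega> \<in> space M. X \<omega> \<in> - (ball 0 1 - {0})} =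
      measure lborel (cball (0::'b) 1 \<inter> - (ball 0 1 - {0})) / measure lborel (cball (0::'b) 1)"
    by (rule prob_uniform_cball[OF X]) auto
  also have "cball (0::'b) 1 \<inter> - (ball 0 1 - {0}) = sphere (0::'b) 1 \<union> {0}"
    by auto
  also have "measure lborel (sphere (0::'b) 1 \<union> {0}) = 0"
    using m by (simp add: measure_eq_0_null_sets)
  finally have "prob {\<omega> \<in> space M. X \<omega> \<in> - (ball 0 1 - {0})} = 0" by simp
  moreover have "{\<omega> \<in> space M. X \<omega> \<in> - (ball 0 1 - {0})} \<in> sets M"
    using X(1) by measurable
  ultimately have "AE \<omega> in M. \<not> X \<omega> \<in> - (ball 0 1 - {0})"
    by (subst (asm) prob_eq_0) auto
  then show ?thesis by simp
qed

text \<open>By independence the joint law is the product law, and each section of the diagonal is a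
  singleton, hence null.\<close>

lemma (in prob_space) AE_indep_uniform_cball_distinct:
  fixes U :: "'i \<Rightarrow> 'a \<Rightarrow> 'b::euclidean_space"
  assumes iv: "indep_vars (\<lambda>_. borel) U I" and ij: "i \<in> I" "j \<in> I" "i \<noteq> j"
    and d: "\<And>i. i \<in> I \<Longrightarrow> distr M borel (U i) = uniform_measure lborel (cball 0 1)"
  shows "AE \<omega> in M. U i \<omega> \<noteq> U j \<omega>"
proof -
  have rv: "U i \<in> borel_measurable M" "U j \<in> borel_measurable M"
    using iv ij unfolding indep_vars_def by auto
  have "indep_var (PiM {i} (\<lambda>_. borel)) (\<lambda>\<omega>. restrict (\<lambda>i. U i \<omega>) {i})
      (PiM {j} (\<lambda>_. borel)) (\<lambda>\<omega>. restrict (\<lambda>i. U i \<omega>) {j})"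
    by (rule indep_var_restrict[OF iv]) (use ij in auto)
  then have "indep_var borel ((\<lambda>f. f i) \<circ> (\<lambda>\<omega>. restrict (\<lambda>i. U i \<omega>) {i}))
      borel ((\<lambda>f. f j) \<circ> (\<lambda>\<omega>. restrict (\<lambda>i. U i \<omega>) {j}))"
    by (rule indep_var_compose) (auto intro: measurable_component_singleton)
  then have "indep_var borel (U i) borel (U j)"
    by (simp add: comp_def)
  then have joint: "distr M borel (U i) \<Otimes>\<^sub>M distr M borel (U j) = distr M (borel \<Otimes>\<^sub>M borel) (\<lambda>\<omega>. (U i \<omega>, U j \<omega>))"
    by (simp add: indep_var_distribution_eq)
  interpret Uj: prob_space "distr M borel (U j)" by (rule prob_space_distr[OF rv(2)])
  define D where "D = {p \<in> space (borel \<Otimes>\<^sub>M borel :: ('b \<times> 'b) measure). fst p = snd p}"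
  have Dm: "D \<in> sets (borel \<Otimes>\<^sub>M borel)" unfolding D_def by measurable
  have "emeasure (distr M borel (U i) \<Otimes>\<^sub>M distr M borel (U j)) D =
      (\<integral>\<^sup>+x. emeasure (distr M borel (U j)) (Pair x -` D) \<partial>distr M borel (U i))"
    by (rule Uj.emeasure_pair_measure_alt) (use Dm in simp)
  also have "\<dots> = (\<integral>\<^sup>+x. 0 \<partial>distr M borel (U i))"
  proof (rule nn_integral_cong)
    fix x :: 'b
    have "Pair x -` D = {x}" by (auto simp: D_def space_pair_measure)
    moreover have "emeasure (uniform_measure lborel (cball 0 1)) {x} = 0"
      using emeasure_mono[of "cball 0 1 \<inter> {x}" "{x}" lborel] by simp
    ultimately show "emeasure (distr M borel (U j)) (Pair x -` D) = 0"
      using d[OF ij(2)] by simp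
  qed
  finally have "emeasure M {\<omega> \<in> space M. U i \<omega> = U j \<omega>} = 0"
    unfolding joint using rv Dm
    by (subst (asm) emeasure_distr) (auto simp: D_def space_pair_measure vimage_def Int_def conj_commute)
  moreover have "{\<omega> \<in> space M. U i \<omega> = U j \<omega>} \<in> sets M" using rv by measurable
  ultimately show ?thesis by (intro AE_I'[of "{\<omega> \<in> space M. U i \<omega> = U j \<omega>}"]) auto
qed

lemma finite_sets_measurable:
  fixes U :: "'i \<Rightarrow> 'v \<Rightarrow> 'a::euclidean_space"
  assumes "finite I" "\<And>i. i \<in> I \<Longrightarrow> U i \<in> borel_measurable M"
  shows "(\<lambda>\<omega>. (\<lambda>i. U i \<omega>) ` I) \<in> measurable M point_sets"
proof (rule measurable_point_setsI)
  fix B :: "'a set" assume "B \<in> sets borel"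
  have "{\<omega> \<in> space M. (\<lambda>i. U i \<omega>) ` I \<inter> B = {}} = {\<omega> \<in> space M. \<forall>i\<in>I. U i \<omega> \<notin> B}"
    by auto
  also have "\<dots> \<in> sets M"
  proof (rule sets.sets_Collect_finite_All[OF _ assms(1)])
    fix i assume "i \<in> I"
    note assms(2)[OF this, measurable]
    show "{\<omega> \<in> space M. U i \<omega> \<notin> B} \<in> sets M" using \<open>B \<in> sets borel\<close> by measurable
  qed
  finally show "{\<omega> \<in> space M. (\<lambda>i. U i \<omega>) ` I \<inter> B = {}} \<in> sets M" .
qed (use assms(1) in \<open>auto intro: finite_locally_finite\<close>)

lemma insert_measurable: "insert x \<in> measurable point_sets point_sets"
proof (rule measurable_point_setsI)
  fix B :: "'a set" assume B: "B \<in> sets borel" "bounded B"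
  have "{I \<in> space point_sets. insert x I \<inter> B = {}}
    = (if x \<in> B then {} else {I \<in> locally_finite_sets. I \<inter> B = {}})" by auto
  then show "{I \<in> space point_sets. insert x I \<inter> B = {}} \<in> sets point_sets"
    using void_event_in_sets[OF B] by simp
qed (auto intro: insert_locally_finite)

lemma Int_measurable:
  assumes A: "A \<in> sets borel"
  shows "(\<lambda>I. I \<inter> A) \<in> measurable point_sets point_sets"
proof (rule measurable_point_setsI)
  fix B :: "'a set" assume B: "B \<in> sets borel" "bounded B"
  have "{I \<in> locally_finite_sets. I \<inter> (A \<inter> B) = {}} \<in> sets point_sets"
    using A B by (intro void_event_in_sets) (auto intro: bounded_subset)
  then show "{I \<in> space point_sets. I \<inter> A \<inter> B = {}} \<in> sets point_sets"
    by (simp add: Int_assoc)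
qed (auto intro: subset_locally_finite)

text \<open>The void events form an intersection-stable generator, so laws of random locally finite sets
  are determined by their avoidance probabilities.\<close>

lemma point_sets_measure_eqI:
  fixes N N' :: "'a::euclidean_space set measure"
  assumes N: "prob_space N" "sets N = sets point_sets" and N': "prob_space N'" "sets N' = sets point_sets"
    and void: "\<And>B. B \<in> sets borel \<Longrightarrow> bounded B \<Longrightarrow>
      measure N {I \<in> locally_finite_sets. I \<inter> B = {}} = measure N' {I \<in> locally_finite_sets. I \<inter> B = {}}"
  shows "N = N'"
proof (rule measure_eqI_generator_eq)
  let ?E = "{{I \<in> locally_finite_sets. I \<inter> B = {}} | B :: 'a set. B \<in> sets borel \<and> bounded B}"
  interpret N: prob_space N by fact
  interpret N': prob_space N' by fact
  show "Int_stable ?E"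
  proof (rule Int_stableI)
    fix a b assume "a \<in> ?E" "b \<in> ?E"
    then obtain A B :: "'a set" where
      "a = {I \<in> locally_finite_sets. I \<inter> A = {}}" "A \<in> sets borel" "bounded A"
      "b = {I \<in> locally_finite_sets. I \<inter> B = {}}" "B \<in> sets borel" "bounded B" by blast
    then show "a \<inter> b \<in> ?E"
      by (intro CollectI exI[of _ "A \<union> B"]) auto
  qed
  show "sets N = sigma_sets locally_finite_sets ?E" "sets N' = sigma_sets locally_finite_sets ?E"
    using N N' sets_point_sets by simp_all
  show "range (\<lambda>_::nat. locally_finite_sets) \<subseteq> ?E" by (auto intro!: exI[of _ "{}"])
  show "emeasure N X = emeasure N' X" if "X \<in> ?E" for X
    using that void by (auto simp: N.emeasure_eq_measure N'.emeasure_eq_measure)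
  show "emeasure N locally_finite_sets \<noteq> \<infinity>"
    by (simp add: N.emeasure_eq_measure)
qed auto

text \<open>The exponentials of \<open>D\<close> and of the rest of the ball recombine, so
  \<open>D\<close> enters only through a \<open>k\<close>th power. The choice \<open>D = {}\<close>
  gives the conditioning event, a general \<open>D\<close> the same event with \<open>D\<close>
  avoided.\<close>

lemma poisson_two_counts:
  fixes P :: "'w \<Rightarrow> 'a::euclidean_space set"
  assumes P: "homogeneous_poisson_process c M P"
    and B: "D \<in> sets borel" "D \<subseteq> cball 0 1" "Ann \<in> sets borel" "bounded Ann" "Ann \<inter> cball 0 1 = {}"
  shows "measure M {\<omega> \<in> space M. card (P \<omega> \<inter> D) = 0 \<and> card (P \<omega> \<inter> (cball 0 1 - D)) = k \<and> card (P \<omega> \<inter> Ann) = 0} =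
    (c * measure lborel (cball 0 1 - D)) ^ k / fact k *
      exp (- (c * measure lborel (cball (0::'a) 1))) * exp (- (c * measure lborel Ann))"
proof -
  have b: "bounded D" "bounded (cball 0 1 - D)" using B(2) by (auto intro: bounded_subset[OF bounded_cball])
  have m: "cball 0 1 - D \<in> sets borel" using B(1) by auto
  have d: "measure lborel (cball 0 1 - D) = measure lborel (cball (0::'a) 1) - measure lborel D"
    using B(1,2) emeasure_cball_finite[where 'a = 'a]
    by (intro measure_Diff) auto
  have "D \<inter> (cball 0 1 - D) = {}" "D \<inter> Ann = {}" "(cball 0 1 - D) \<inter> Ann = {}"
    using B(2,5) by auto
  from poisson_indep3[OF P B(1) b(1) m b(2) B(3,4) this] show ?thesis
    by (simp add: poisson_card_eq[OF P] B m b d exp_add[symmetric] algebra_simps)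
qed

text \<open>Given the event \<open>E\<close>, the process in the unit ball is a binomial process. In
  the conditional probability of avoiding \<open>B\<close> everything cancels except the
  \<open>k\<close>th power of the volume fraction outside \<open>B\<close>, which is the probability
  that \<open>k\<close> independent uniform points miss \<open>B\<close>.\<close>

lemma poisson_conditioned_binomial:
  fixes P :: "'w \<Rightarrow> 'a::euclidean_space set" and U :: "nat \<Rightarrow> 'v \<Rightarrow> 'a"
  assumes P: "homogeneous_poisson_process c M P" and c: "c > 0"
    and Ann: "Ann \<in> sets borel" "bounded Ann" "Ann \<inter> cball 0 1 = {}"
    and M': "prob_space M'" and iv: "prob_space.indep_vars M' (\<lambda>_. borel) U {1..k}"
    and d: "\<And>i. i \<in> {1..k} \<Longrightarrow> distr M' borel (U i) = uniform_measure lborel (cball 0 1)"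
    and C: "C \<in> sets point_sets"
  defines "E \<equiv> {\<omega> \<in> space M. card (P \<omega> \<inter> cball 0 1) = k \<and> card (P \<omega> \<inter> Ann) = 0}"
  shows "measure M {\<omega> \<in> E. P \<omega> \<inter> cball 0 1 \<in> C} =
      measure M E * measure M' {\<omega> \<in> space M'. (\<lambda>i. U i \<omega>) ` {1..k} \<in> C}"
    and "measure M E = (c * measure lborel (cball (0::'a) 1)) ^ k / fact k *
      exp (- (c * measure lborel (cball (0::'a) 1))) * exp (- (c * measure lborel Ann))"
proof -
  interpret M: prob_space M using P by (simp add: homogeneous_poisson_process_def)
  interpret M': prob_space M' by fact
  let ?V = "measure lborel (cball (0::'a) 1)"
  have V: "?V > 0" by (rule measure_cball_pos)
  have rv: "U i \<in> borel_measurable M'" if "i \<in> {1..k}" for i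
    using iv that unfolding M'.indep_vars_def by auto
  have fin: "finite (P \<omega> \<inter> cball 0 1)" if "\<omega> \<in> space M" for \<omega>
    using finite_Int_bounded[OF poisson_locally_finite[OF P that] bounded_cball] .
  show E: "measure M E = (c * ?V) ^ k / fact k * exp (- (c * ?V)) * exp (- (c * measure lborel Ann))"
    using poisson_two_counts[OF P, of "{}" Ann k] Ann by (simp add: E_def)
  have Epos: "measure M E > 0" unfolding E using c V by simp
  have [measurable]: "(\<lambda>\<omega>. card (P \<omega> \<inter> cball 0 1)) \<in> measurable M (count_space UNIV)"
      "(\<lambda>\<omega>. card (P \<omega> \<inter> Ann)) \<in> measurable M (count_space UNIV)"
    using P Ann by (simp_all add: homogeneous_poisson_process_def)
  have Em: "E \<in> sets M" unfolding E_def by measurable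
  define N where "N = distr (uniform_measure M E) point_sets (\<lambda>\<omega>. P \<omega> \<inter> cball 0 1)"
  define N' where "N' = distr M' point_sets (\<lambda>\<omega>. (\<lambda>i. U i \<omega>) ` {1..k})"
  have um: "prob_space (uniform_measure M E)"
    using Epos by (intro prob_space_uniform_measure) (auto simp: M.emeasure_eq_measure)
  have Pm: "(\<lambda>\<omega>. P \<omega> \<inter> cball 0 1) \<in> measurable M point_sets"
    by (rule measurable_compose[OF poisson_measurable[OF P] Int_measurable]) auto
  then have Pm': "(\<lambda>\<omega>. P \<omega> \<inter> cball 0 1) \<in> measurable (uniform_measure M E) point_sets"
    by (simp add: measurable_cong_sets[OF sets_uniform_measure refl])
  have Um: "(\<lambda>\<omega>. (\<lambda>i. U i \<omega>) ` {1..k}) \<in> measurable M' point_sets"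
    by (rule finite_sets_measurable) (use rv in auto)
  have N_eq: "measure N X = measure M {\<omega> \<in> E. P \<omega> \<inter> cball 0 1 \<in> X} / measure M E"
    if X: "X \<in> sets point_sets" for X
  proof -
    have "(\<lambda>\<omega>. P \<omega> \<inter> cball 0 1) -` X \<inter> space M \<in> sets M" by (rule measurable_sets[OF Pm X])
    moreover have "E \<inter> ((\<lambda>\<omega>. P \<omega> \<inter> cball 0 1) -` X \<inter> space M) = {\<omega> \<in> E. P \<omega> \<inter> cball 0 1 \<in> X}"
      by (auto simp: E_def)
    ultimately show ?thesis
      unfolding N_def using Epos
      by (subst measure_distr[OF Pm' X], simp only: space_uniform_measure, subst measure_uniform_measure)
        (auto simp: M.emeasure_eq_measure)
  qed
  have N'_eq: "measure N' X = measure M' {\<omega> \<in> space M'. (\<lambda>i. U i \<omega>) ` {1..k} \<in> X}"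
    if X: "X \<in> sets point_sets" for X
    unfolding N'_def by (subst measure_distr[OF Um X]) (auto intro!: arg_cong[of _ _ "measure M'"])
  have "N = N'"
  proof (rule point_sets_measure_eqI)
    show "prob_space N" unfolding N_def by (rule prob_space.prob_space_distr[OF um Pm'])
    show "prob_space N'" unfolding N'_def by (rule M'.prob_space_distr[OF Um])
    show "sets N = sets point_sets" "sets N' = sets point_sets" by (simp_all add: N_def N'_def)
    fix B :: "'a set" assume B: "B \<in> sets borel" "bounded B"
    let ?X = "{I \<in> locally_finite_sets. I \<inter> B = {}}"
    let ?D = "cball 0 1 \<inter> B"
    have "{\<omega> \<in> E. P \<omega> \<inter> cball 0 1 \<in> ?X} =
      {\<omega> \<in> space M. card (P \<omega> \<inter> ?D) = 0 \<and> card (P \<omega> \<inter> (cball 0 1 - ?D)) = k \<and> card (P \<omega> \<inter> Ann) = 0}"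
    proof -
      have "(card (P \<omega> \<inter> cball 0 1) = k \<and> P \<omega> \<inter> cball 0 1 \<in> ?X) \<longleftrightarrow>
          (card (P \<omega> \<inter> ?D) = 0 \<and> card (P \<omega> \<inter> (cball 0 1 - ?D)) = k)" if \<omega>: "\<omega> \<in> space M" for \<omega>
      proof -
        have "P \<omega> \<inter> cball 0 1 \<in> locally_finite_sets"
          by (rule finite_locally_finite) (rule fin[OF \<omega>])
        then have "P \<omega> \<inter> cball 0 1 \<in> ?X \<longleftrightarrow> P \<omega> \<inter> ?D = {}" by auto
        also have "\<dots> \<longleftrightarrow> card (P \<omega> \<inter> ?D) = 0"
          using fin[OF \<omega>] by (subst card_eq_0_iff) (auto simp: Int_assoc[symmetric])
        moreover have "P \<omega> \<inter> (cball 0 1 - ?D) = P \<omega> \<inter> cball 0 1" if "P \<omega> \<inter> ?D = {}"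
          using that by auto
        ultimately show ?thesis by auto
      qed
      then show ?thesis by (auto simp: E_def)
    qed
    then have "measure N ?X = ((c * measure lborel (cball 0 1 - ?D)) ^ k / fact k *
      exp (- (c * ?V)) * exp (- (c * measure lborel Ann))) / measure M E"
      using N_eq[OF void_event_in_sets[OF B]] poisson_two_counts[OF P _ _ Ann, of ?D k] B by simp
    also have "\<dots> = (measure lborel (cball 0 1 - ?D) / ?V) ^ k"
      unfolding E using c V by (simp add: field_simps power_divide)
    also have "\<dots> = measure M' {\<omega> \<in> space M'. (\<lambda>i. U i \<omega>) ` {1..k} \<in> ?X}"
    \<comment> \<open>The product formula for independent variables requires a nonempty index
      set.\<close>
    proof (cases "k = 0")
      case True
      then show ?thesis using finite_locally_finite[of "{} :: 'a set"] by (simp add: M'.prob_space)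
    next
      case False
      have "{\<omega> \<in> space M'. (\<lambda>i. U i \<omega>) ` {1..k} \<in> ?X} = (\<Inter>i\<in>{1..k}. U i -` (- B) \<inter> space M')"
        using False by (auto intro: finite_locally_finite)
      then have "measure M' {\<omega> \<in> space M'. (\<lambda>i. U i \<omega>) ` {1..k} \<in> ?X} =
          (\<Prod>i\<in>{1..k}. measure M' (U i -` (- B) \<inter> space M'))"
        using M'.indep_varsD_finite[OF iv, of "\<lambda>_. - B"] False B(1) by simp
      also have "\<dots> = (\<Prod>i\<in>{1..k}. measure lborel (cball 0 1 - ?D) / ?V)"
      proof (rule prod.cong[OF refl])
        fix i assume i: "i \<in> {1..k}"
        have "measure M' (U i -` (- B) \<inter> space M') = measure M' {\<omega> \<in> space M'. U i \<omega> \<in> - B}"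
          by (auto intro!: arg_cong[of _ _ "measure M'"])
        also have "\<dots> = measure lborel (cball 0 1 \<inter> - B) / ?V"
          by (rule prob_uniform_cball[OF rv[OF i] d[OF i]]) (use B in auto)
        also have "cball 0 1 \<inter> - B = cball 0 1 - ?D" by auto
        finally show "measure M' (U i -` (- B) \<inter> space M') = measure lborel (cball 0 1 - ?D) / ?V" .
      qed
      finally show ?thesis by simp
    qed
    also have "\<dots> = measure N' ?X" by (rule N'_eq[OF void_event_in_sets[OF B], symmetric])
    finally show "measure N ?X = measure N' ?X" .
  qed
  then show "measure M {\<omega> \<in> E. P \<omega> \<inter> cball 0 1 \<in> C} =
      measure M E * measure M' {\<omega> \<in> space M'. (\<lambda>i. U i \<omega>) ` {1..k} \<in> C}"
    using N_eq[OF C] N'_eq[OF C] Epos by simp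
qed

section \<open>The tail configuration\<close>

text \<open>Multiplication by \<open>u\<close> carries the ball of radius \<open>inverse u\<close>
  to the unit ball. The origin is removed because \<open>P\<close> may contain it, while
  \<open>knn_dist\<close> ignores the point it is taken at.\<close>

lemma knn_exceedance_eq:
  fixes P :: "'a::euclidean_space set"
  assumes "P \<in> locally_finite_sets" "k \<ge> 1" "u > 0"
  shows "score_at (knn_config k (insert 0 P)) 0 > u \<longleftrightarrow>
    k \<le> card ((*\<^sub>R) u ` P \<inter> (ball 0 1 - {0}))"
proof -
  have n: "norm (u *\<^sub>R x) < 1 \<longleftrightarrow> norm x < inverse u" for x :: 'a
    using assms(3) by (simp add: field_simps)
  have "(*\<^sub>R) u ` P \<inter> (ball 0 1 - {0}) = (*\<^sub>R) u ` ((insert 0 P - {0}) \<inter> ball 0 (inverse u))"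
    using assms(3) n by auto
  then have "card ((*\<^sub>R) u ` P \<inter> (ball 0 1 - {0})) = card ((insert 0 P - {0}) \<inter> ball 0 (inverse u))"
    using assms(3) by (simp add: card_image inj_on_def)
  then show ?thesis
    using score_at_knn_config_gt_iff[OF insert_locally_finite[OF assms(1)] assms(2,3), of 0 0] by simp
qed

text \<open>Up to conditional probability \<open>O(u\<^sup>-\<^sup>d)\<close>, an exceedance is caused by exactly \<open>k\<close> rescaled points in the unit
  ball with no other point in \<open>ball 0 R\<close>; these \<open>k\<close> points are then i.i.d. uniform.\<close>

lemma knn_tail_lower_bound:
  fixes P :: "'w \<Rightarrow> 'a::euclidean_space set" and U :: "nat \<Rightarrow> 'v \<Rightarrow> 'a"
  assumes k: "k \<ge> 1" and P: "homogeneous_poisson_process 1 M P" and u: "u > 0" and R: "R \<ge> 3"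
    and M': "prob_space M'" and iv: "prob_space.indep_vars M' (\<lambda>_. borel) U {1..k}"
    and d: "\<And>i. i \<in> {1..k} \<Longrightarrow> distr M' borel (U i) = uniform_measure lborel (cball 0 1)"
    and Km: "{I \<in> locally_finite_sets. knn_config k (insert 0 I) \<in> K} \<in> sets point_sets"
    and Kloc: "\<And>I. I \<in> locally_finite_sets \<Longrightarrow> I \<inter> ball 0 R \<subseteq> cball 0 1 \<Longrightarrow> card (I \<inter> ball 0 R) = Suc k \<Longrightarrow>
      knn_config k I \<in> K \<longleftrightarrow> knn_config k (I \<inter> ball 0 R) \<in> K"
  defines "A \<equiv> {\<omega> \<in> space M. score_at (knn_palm_version k P \<omega>) 0 > u}"
  shows "A \<in> sets M" and "measure M A > 0"
    and "measure M' {\<omega> \<in> space M'. knn_config k (insert 0 ((\<lambda>i. U i \<omega>) ` {1..k})) \<in> K} *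
        exp (- (inverse u ^ DIM('a) * measure lborel (ball (0::'a) R)))
      \<le> measure M {\<omega> \<in> A. knn_config k (insert 0 ((*\<^sub>R) u ` P \<omega>)) \<in> K} / measure M A"
proof -
  interpret M: prob_space M using P by (simp add: homogeneous_poisson_process_def)
  interpret M': prob_space M' by fact
  define c where "c = inverse u ^ DIM('a)"
  have c: "c > 0" using u by (simp add: c_def)
  define Q where "Q \<omega> = (*\<^sub>R) u ` P \<omega>" for \<omega>
  have Q: "homogeneous_poisson_process c M Q"
    using poisson_process_scale[OF P u] unfolding Q_def c_def by simp
  note Qlf = poisson_locally_finite[OF Q]
  note Qm = poisson_measurable[OF Q]
  have A_eq: "A = {\<omega> \<in> space M. k \<le> card (Q \<omega> \<inter> (ball 0 1 - {0}))}"
    using knn_exceedance_eq[OF poisson_locally_finite[OF P] k u]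
    by (auto simp: A_def Q_def knn_palm_version_def knn_process_def knn_config_def)
  have cm: "(\<lambda>\<omega>. card (Q \<omega> \<inter> B)) \<in> measurable M (count_space UNIV)"
    if "B \<in> sets borel" "bounded B" for B
    using Q that by (simp add: homogeneous_poisson_process_def)
  have bd: "ball (0::'a) 1 - {0} \<in> sets borel" "bounded (ball (0::'a) 1 - {0})"
    by (auto intro: bounded_subset[OF bounded_ball])
  show Am: "A \<in> sets M"
    unfolding A_eq using cm[OF bd] by measurable
  define Ann where "Ann = ball (0::'a) R - cball 0 1"
  have Ann: "Ann \<in> sets borel" "bounded Ann" "Ann \<inter> cball 0 1 = {}"
    by (auto simp: Ann_def intro: bounded_subset[OF bounded_ball])
  define E where "E = {\<omega> \<in> space M. card (Q \<omega> \<inter> cball 0 1) = k \<and> card (Q \<omega> \<inter> Ann) = 0}"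
  let ?V = "measure lborel (cball (0::'a) 1)"
  have V: "?V > 0" by (rule measure_cball_pos)
  have VR: "?V + measure lborel Ann = measure lborel (ball (0::'a) R)"
  proof -
    have "cball (0::'a) 1 \<subseteq> ball 0 R" using R by auto
    then have "measure lborel Ann = measure lborel (ball (0::'a) R) - ?V"
      unfolding Ann_def using emeasure_lborel_ball_finite[of "0::'a" R] by (intro measure_Diff) auto
    then show ?thesis by simp
  qed
  have PE: "measure M E = (c * ?V) ^ k / fact k * exp (- (c * measure lborel (ball (0::'a) R)))"
    unfolding E_def VR[symmetric]
    by (subst poisson_conditioned_binomial(2)[OF Q c Ann M' iv d Km])
      (auto simp: exp_add[symmetric] algebra_simps)
  have rv: "U i \<in> borel_measurable M'" if "i \<in> {1..k}" for i
    using iv that unfolding M'.indep_vars_def by auto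
  have aeU: "AE \<omega> in M'. \<forall>i\<in>{1..k}. U i \<omega> \<in> ball 0 1 - {0}"
    by (intro AE_finite_allI M'.AE_uniform_cball rv d) auto
  \<comment> \<open>Stated for general \<open>L\<close> since it serves twice:
    \<open>L = UNIV\<close> shows that exceedances have positive probability, \<open>L = K\<close>
    gives the bound.\<close>
  have step: "measure M E * measure M' {\<omega> \<in> space M'. knn_config k (insert 0 ((\<lambda>i. U i \<omega>) ` {1..k})) \<in> L}
      \<le> measure M {\<omega> \<in> A. knn_config k (insert 0 (Q \<omega>)) \<in> L}"
    if Lm: "{I \<in> locally_finite_sets. knn_config k (insert 0 I) \<in> L} \<in> sets point_sets"
      and Lloc: "\<And>I. I \<in> locally_finite_sets \<Longrightarrow> I \<inter> ball 0 R \<subseteq> cball 0 1 \<Longrightarrow> card (I \<inter> ball 0 R) = Suc k \<Longrightarrow>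
        knn_config k I \<in> L \<longleftrightarrow> knn_config k (I \<inter> ball 0 R) \<in> L" for L
  proof -
    \<comment> \<open>Excluding the sphere and the origin costs nothing almost surely for the
      uniform points. It puts the \<open>k\<close> points into the open punctured ball, so that an
      exceedance occurs, and makes the inserted origin a new point, giving the \<open>Suc k\<close>
      points of the locality hypothesis.\<close>
    define C where "C = {I \<in> locally_finite_sets. I \<inter> (sphere 0 1 \<union> {0}) = {}} \<inter>
      {I \<in> locally_finite_sets. knn_config k (insert 0 I) \<in> L}"
    have Cm: "C \<in> sets point_sets"
      unfolding C_def by (intro sets.Int Lm void_event_in_sets) auto
    have lf: "(\<lambda>i. U i \<omega>) ` {1..k} \<in> locally_finite_sets" for \<omega>
      by (rule finite_locally_finite) simp
    have Um: "(\<lambda>\<omega>. (\<lambda>i. U i \<omega>) ` {1..k}) \<in> measurable M' point_sets"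
      by (rule finite_sets_measurable) (use rv in auto)
    have "measure M' {\<omega> \<in> space M'. knn_config k (insert 0 ((\<lambda>i. U i \<omega>) ` {1..k})) \<in> L}
        = measure M' {\<omega> \<in> space M'. (\<lambda>i. U i \<omega>) ` {1..k} \<in> C}"
    proof (rule M'.finite_measure_eq_AE)
      show "AE \<omega> in M'. \<omega> \<in> {\<omega> \<in> space M'. knn_config k (insert 0 ((\<lambda>i. U i \<omega>) ` {1..k})) \<in> L} \<longleftrightarrow>
          \<omega> \<in> {\<omega> \<in> space M'. (\<lambda>i. U i \<omega>) ` {1..k} \<in> C}"
        using aeU by eventually_elim (use lf in \<open>auto simp: C_def\<close>)
      have "{\<omega> \<in> space M'. (\<lambda>i. U i \<omega>) ` {1..k} \<in> X} \<in> sets M'" if "X \<in> sets point_sets" for X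
        using measurable_sets[OF Um that] by (simp add: vimage_def Int_def conj_commute)
      from this[OF Lm] this[OF Cm]
      show "{\<omega> \<in> space M'. knn_config k (insert 0 ((\<lambda>i. U i \<omega>) ` {1..k})) \<in> L} \<in> sets M'"
        "{\<omega> \<in> space M'. (\<lambda>i. U i \<omega>) ` {1..k} \<in> C} \<in> sets M'"
        using lf by simp_all
    qed
    then have "measure M E * measure M' {\<omega> \<in> space M'. knn_config k (insert 0 ((\<lambda>i. U i \<omega>) ` {1..k})) \<in> L}
        = measure M {\<omega> \<in> E. Q \<omega> \<inter> cball 0 1 \<in> C}"
      unfolding E_def using poisson_conditioned_binomial(1)[OF Q c Ann M' iv d Cm] by simp
    also have "\<dots> \<le> measure M {\<omega> \<in> A. knn_config k (insert 0 (Q \<omega>)) \<in> L}"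
    proof (rule M.finite_measure_mono)
      show "{\<omega> \<in> E. Q \<omega> \<inter> cball 0 1 \<in> C} \<subseteq> {\<omega> \<in> A. knn_config k (insert 0 (Q \<omega>)) \<in> L}"
      proof
        fix \<omega> assume "\<omega> \<in> {\<omega> \<in> E. Q \<omega> \<inter> cball 0 1 \<in> C}"
        then have \<omega>: "\<omega> \<in> space M" and card: "card (Q \<omega> \<inter> cball 0 1) = k" and ann: "card (Q \<omega> \<inter> Ann) = 0"
          and sph: "Q \<omega> \<inter> cball 0 1 \<inter> (sphere 0 1 \<union> {0}) = {}"
          and L: "knn_config k (insert 0 (Q \<omega> \<inter> cball 0 1)) \<in> L"
          by (auto simp: E_def C_def)
        have fin: "finite (Q \<omega> \<inter> cball 0 1)" "finite (Q \<omega> \<inter> Ann)"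
          using finite_Int_bounded[OF Qlf[OF \<omega>]] Ann(2) by auto
        have "Q \<omega> \<inter> Ann = {}" using ann fin(2) by simp
        then have QR: "Q \<omega> \<inter> ball 0 R = Q \<omega> \<inter> cball 0 1" using R by (auto simp: Ann_def)
        have "Q \<omega> \<inter> (ball 0 1 - {0}) = Q \<omega> \<inter> cball 0 1" using sph by fastforce
        then have "\<omega> \<in> A" using card \<omega> by (simp add: A_eq)
        moreover have ins: "insert 0 (Q \<omega>) \<inter> ball 0 R = insert 0 (Q \<omega> \<inter> cball 0 1)"
          using R QR by auto
        moreover have "0 \<notin> Q \<omega> \<inter> cball 0 1" using sph by auto
        ultimately show "\<omega> \<in> {\<omega> \<in> A. knn_config k (insert 0 (Q \<omega>)) \<in> L}"
          using Lloc[OF insert_locally_finite[OF Qlf[OF \<omega>]], of 0] fin(1) card L by auto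
      qed
      have "{\<omega> \<in> space M. Q \<omega> \<in> {I \<in> locally_finite_sets. knn_config k (insert 0 I) \<in> L}} \<in> sets M"
        using measurable_sets[OF Qm Lm] by (simp add: vimage_def Int_def conj_commute)
      then have "A \<inter> {\<omega> \<in> space M. Q \<omega> \<in> {I \<in> locally_finite_sets. knn_config k (insert 0 I) \<in> L}} \<in> sets M"
        using Am by (rule sets.Int[rotated])
      also have "A \<inter> {\<omega> \<in> space M. Q \<omega> \<in> {I \<in> locally_finite_sets. knn_config k (insert 0 I) \<in> L}}
          = {\<omega> \<in> A. knn_config k (insert 0 (Q \<omega>)) \<in> L}"
        using Qlf by (auto simp: A_def)
      finally show "{\<omega> \<in> A. knn_config k (insert 0 (Q \<omega>)) \<in> L} \<in> sets M" .
    qed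
    finally show ?thesis .
  qed
  have Epos: "measure M E > 0" unfolding PE using c V by simp
  have "measure M E * measure M' {\<omega> \<in> space M'. True} \<le> measure M {\<omega> \<in> A. True}"
    using step[of UNIV] sets.top[of "point_sets :: 'a set measure"] by simp
  then show Apos: "measure M A > 0" using Epos by (simp add: M'.prob_space)
  have "measure M A \<le> measure M {\<omega> \<in> space M. k \<le> card (Q \<omega> \<inter> cball 0 1)}"
  proof (rule M.finite_measure_mono)
    have "card (Q \<omega> \<inter> (ball 0 1 - {0})) \<le> card (Q \<omega> \<inter> cball 0 1)" if "\<omega> \<in> space M" for \<omega>
      by (rule card_mono) (use finite_Int_bounded[OF Qlf[OF that] bounded_cball] in auto)
    then show "A \<subseteq> {\<omega> \<in> space M. k \<le> card (Q \<omega> \<inter> cball 0 1)}"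
      by (auto simp: A_eq intro: order_trans)
    show "{\<omega> \<in> space M. k \<le> card (Q \<omega> \<inter> cball 0 1)} \<in> sets M"
      using cm[of "cball 0 1"] by simp
  qed
  also have "\<dots> \<le> (c * ?V) ^ k / fact k"
    using c by (intro poisson_tail_bound[OF Q]) auto
  finally have PA: "measure M A \<le> (c * ?V) ^ k / fact k" .
  let ?p = "measure M' {\<omega> \<in> space M'. knn_config k (insert 0 ((\<lambda>i. U i \<omega>) ` {1..k})) \<in> K}"
  let ?x = "exp (- (c * measure lborel (ball (0::'a) R)))"
  \<comment> \<open>The upper bound for \<open>A\<close> is exactly the prefactor in
    \<open>PE\<close>, so the quotient needs no asymptotic expansion.\<close>
  have "?p * ?x * measure M A \<le> ?p * ?x * ((c * ?V) ^ k / fact k)"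
    by (rule mult_left_mono[OF PA]) simp
  also have "\<dots> = measure M E * ?p" by (simp add: PE)
  also have "\<dots> \<le> measure M {\<omega> \<in> A. knn_config k (insert 0 (Q \<omega>)) \<in> K}"
    by (rule step[OF Km Kloc])
  finally show "?p * exp (- (inverse u ^ DIM('a) * measure lborel (ball (0::'a) R)))
      \<le> measure M {\<omega> \<in> A. knn_config k (insert 0 ((*\<^sub>R) u ` P \<omega>)) \<in> K} / measure M A"
    using Apos by (simp add: pos_le_divide_eq c_def Q_def)
qed

lemma regularly_varying_inverse: "regularly_varying (- 1) (\<lambda>u. inverse u)"
  unfolding regularly_varying_def
proof (intro conjI allI impI)
  show "(\<lambda>u::real. inverse u) \<in> borel_measurable (restrict_space borel {0<..})"
    by (intro measurable_restrict_space1) simp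
  fix c :: real assume c: "c > 0"
  have "eventually (\<lambda>u. c powr - 1 = inverse (c * u) / inverse u) at_top"
    using eventually_gt_at_top[of 0]
    by eventually_elim (use c in \<open>simp add: powr_minus field_simps\<close>)
  then show "((\<lambda>u. inverse (c * u) / inverse u) \<longlongrightarrow> c powr - 1) at_top"
    by (rule Lim_transform_eventually[OF tendsto_const])
qed

text \<open>Almost surely the \<open>k\<close> points are distinct, nonzero and inside the open unit
  ball, so the \<open>k\<close>th neighbour of the origin is at distance below 1.\<close>

lemma AE_knn_config_score_gt_1:
  fixes U :: "nat \<Rightarrow> 'v \<Rightarrow> 'a::euclidean_space"
  assumes k: "k \<ge> 1" and M': "prob_space M'" and iv: "prob_space.indep_vars M' (\<lambda>_. borel) U {1..k}"
    and d: "\<And>i. i \<in> {1..k} \<Longrightarrow> distr M' borel (U i) = uniform_measure lborel (cball 0 1)"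
  shows "AE \<omega> in M'. emeasure (knn_config k (insert 0 ((\<lambda>i. U i \<omega>) ` {1..k}))) ({0} \<times> {1<..}) = 1"
proof -
  interpret prob_space M' by fact
  have rv: "U i \<in> borel_measurable M'" if "i \<in> {1..k}" for i
    using iv that unfolding indep_vars_def by auto
  have "AE \<omega> in M'. \<forall>i\<in>{1..k}. U i \<omega> \<in> ball 0 1 - {0}"
    by (intro AE_finite_allI AE_uniform_cball rv d) auto
  moreover have "AE \<omega> in M'. i \<noteq> j \<longrightarrow> U i \<omega> \<noteq> U j \<omega>" if "i \<in> {1..k}" "j \<in> {1..k}" for i j
    using AE_indep_uniform_cball_distinct[OF iv that _ d] by (cases "i = j") auto
  then have "AE \<omega> in M'. \<forall>i\<in>{1..k}. \<forall>j\<in>{1..k}. i \<noteq> j \<longrightarrow> U i \<omega> \<noteq> U j \<omega>"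
    by (intro AE_finite_allI) auto
  ultimately show ?thesis
  proof eventually_elim
    case (elim \<omega>)
    define W where "W = (\<lambda>i. U i \<omega>) ` {1..k}"
    have W: "W \<subseteq> ball 0 1 - {0}" using elim(1) by (auto simp: W_def)
    have "inj_on (\<lambda>i. U i \<omega>) {1..k}" using elim(2) by (auto simp: inj_on_def)
    then have card: "card W = k" by (simp add: W_def card_image)
    have lf: "insert 0 W \<in> locally_finite_sets" by (rule finite_locally_finite) (simp add: W_def)
    have "(insert 0 W - {0}) \<inter> ball 0 (inverse 1) = W" using W by auto
    then have gt: "real_of_ereal (inverse (knn_dist k 0 (insert 0 W))) > 1"
      unfolding knn_score_gt_iff[OF lf k zero_less_one] knn_dist_less_iff[OF lf k] by (simp add: card)
    have m: "{0} \<times> {1<..} \<in> sets (pos_score_borel :: ('a \<times> real) measure)"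
      unfolding sets_pos_score_borel_iff pos_score_space_def by (auto intro: borel_Times)
    have "insert 0 W \<inter> {0} \<inter> {t. (t, real_of_ereal (inverse (knn_dist k t (insert 0 W)))) \<in> {0} \<times> {1<..}} = {0}"
      using gt by (auto simp del: real_of_ereal_inverse)
    then show ?case
      unfolding W_def[symmetric]
      by (subst emeasure_knn_config[OF lf m, of "{0}"]) (auto simp del: real_of_ereal_inverse)
  qed
qed

theorem proposition5p1:
  fixes M :: "'w measure" and P :: "'w \<Rightarrow> 'a::euclidean_space set"
    and M' :: "'v measure" and U :: "nat \<Rightarrow> 'v \<Rightarrow> 'a" and k :: nat
  assumes "k \<ge> 1"
    and "homogeneous_poisson_process 1 M P"
    and "prob_space M'"
    and "U 0 = (\<lambda>_. 0)"
    and "prob_space.indep_vars M' (\<lambda>_. borel) U {1..k}"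
    and "\<And>i. i \<in> {1..k} \<Longrightarrow> distr M' borel (U i) = uniform_measure lborel (cball 0 1)"
  shows "tail_configuration_of_palm M (knn_palm_version k P)
           M' (knn_process k (\<lambda>\<omega>. {U i \<omega> | i. i \<in> {0..k}})) (\<lambda>u. inverse u) (- 1)"
proof -
  note k = assms(1) and P = assms(2) and M' = assms(3) and iv = assms(5) and d = assms(6)
  interpret M: prob_space M using P by (simp add: homogeneous_poisson_process_def)
  interpret M': prob_space M' by fact
  let ?B = "borel_of_topology vague_topology :: ('a \<times> real) measure measure"
  define Z where "Z \<omega> = insert 0 ((\<lambda>i. U i \<omega>) ` {1..k})" for \<omega>
  have "{U i \<omega> | i. i \<in> {0..k}} = Z \<omega>" for \<omega>
  proof -
    have "{0..k} = insert 0 {1..k}" by auto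
    then show ?thesis by (simp only: Setcompr_eq_image Z_def image_insert assms(4))
  qed
  then have Y_eq: "knn_process k (\<lambda>\<omega>. {U i \<omega> | i. i \<in> {0..k}}) = (\<lambda>\<omega>. knn_config k (Z \<omega>))"
    by (simp add: fun_eq_iff knn_process_def knn_config_def)
  have X_eq: "knn_palm_version k P = (\<lambda>\<omega>. knn_config k (insert 0 (P \<omega>)))"
    by (simp add: fun_eq_iff knn_palm_version_def knn_process_def knn_config_def)
  have cfgm: "(\<lambda>I. knn_config k (insert 0 I)) \<in> measurable point_sets ?B"
    by (rule measurable_compose[OF insert_measurable measurable_knn_config[OF k]])
  have Xm: "(\<lambda>\<omega>. knn_config k (insert 0 (P \<omega>))) \<in> measurable M ?B"
    by (rule measurable_compose[OF poisson_measurable[OF P] cfgm])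
  have rv: "U i \<in> borel_measurable M'" if "i \<in> {1..k}" for i
    using iv that unfolding M'.indep_vars_def by auto
  have Ym: "(\<lambda>\<omega>. knn_config k (Z \<omega>)) \<in> measurable M' ?B"
    unfolding Z_def by (rule measurable_compose[OF finite_sets_measurable cfgm]) (use rv in auto)
  have SXm: "(\<lambda>\<omega>. knn_config k (insert 0 ((*\<^sub>R) u ` P \<omega>))) \<in> measurable M ?B" if "u > 0" for u
    by (rule measurable_compose[OF poisson_measurable[OF poisson_process_scale[OF P that]] cfgm])
  have scal: "scaling (inverse u) u (knn_config k (insert 0 (P \<omega>))) = knn_config k (insert 0 ((*\<^sub>R) u ` P \<omega>))"
    if "u > 0" for u \<omega>
    using scaling_knn_config[OF that, of k "insert 0 (P \<omega>)"] by simp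
  define A where "A u = {\<omega> \<in> space M. score_at (knn_palm_version k P \<omega>) 0 > u}" for u
  \<comment> \<open>The trivial event, used with \<open>R = 3\<close>, serves to extract that the
    exceedance is measurable and has positive probability, so that conditioning on it makes
    sense.\<close>
  have Ktriv: "{I \<in> locally_finite_sets. knn_config k (insert 0 I) \<in> UNIV} \<in> sets (point_sets :: 'a set measure)"
    using sets.top[of "point_sets :: 'a set measure"] by simp
  have A: "A u \<in> sets M" "measure M (A u) > 0" if "u > 0" for u
    unfolding A_def by (rule knn_tail_lower_bound[OF k P that order_refl M' iv d Ktriv]; simp)+
  define Q where "Q u = distr (uniform_measure M (A u)) ?B
      (\<lambda>\<omega>. scaling (inverse u) u (knn_config k (insert 0 (P \<omega>))))" for u
  have Q: "prob_space (Q u)" "sets (Q u) = sets ?B"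
    "W \<in> sets ?B \<Longrightarrow> measure (Q u) W =
      measure M {\<omega> \<in> A u. knn_config k (insert 0 ((*\<^sub>R) u ` P \<omega>)) \<in> W} / measure M (A u)"
    if u: "u > 0" for u W
  proof -
    have um: "prob_space (uniform_measure M (A u))"
      using A(2)[OF u] by (intro prob_space_uniform_measure) (auto simp: M.emeasure_eq_measure)
    have m: "(\<lambda>\<omega>. knn_config k (insert 0 ((*\<^sub>R) u ` P \<omega>))) \<in> measurable (uniform_measure M (A u)) ?B"
      using SXm[OF u] by (simp add: measurable_cong_sets[OF sets_uniform_measure refl])
    have Q_eq: "Q u = distr (uniform_measure M (A u)) ?B (\<lambda>\<omega>. knn_config k (insert 0 ((*\<^sub>R) u ` P \<omega>)))"
      unfolding Q_def scal[OF u] by simp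
    show "prob_space (Q u)" unfolding Q_eq by (rule prob_space.prob_space_distr[OF um m])
    show "sets (Q u) = sets ?B" unfolding Q_eq by simp
    assume W: "W \<in> sets ?B"
    have "(\<lambda>\<omega>. knn_config k (insert 0 ((*\<^sub>R) u ` P \<omega>))) -` W \<inter> space M \<in> sets M"
      by (rule measurable_sets[OF SXm[OF u] W])
    moreover have "A u \<inter> ((\<lambda>\<omega>. knn_config k (insert 0 ((*\<^sub>R) u ` P \<omega>))) -` W \<inter> space M) =
        {\<omega> \<in> A u. knn_config k (insert 0 ((*\<^sub>R) u ` P \<omega>)) \<in> W}"
      by (auto simp: A_def)
    ultimately show "measure (Q u) W =
      measure M {\<omega> \<in> A u. knn_config k (insert 0 ((*\<^sub>R) u ` P \<omega>)) \<in> W} / measure M (A u)"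
      unfolding Q_eq using A(2)[OF u]
      by (subst measure_distr[OF m W], simp only: space_uniform_measure, subst measure_uniform_measure)
        (auto simp: M.emeasure_eq_measure)
  qed
  have "weakly_converges vague_topology Q (distr M' ?B (\<lambda>\<omega>. knn_config k (Z \<omega>))) at_top"
  proof (rule weakly_convergesI_open)
    show "eventually (\<lambda>u. prob_space (Q u) \<and> sets (Q u) = sets ?B) at_top"
      using eventually_gt_at_top[of 0] by eventually_elim (use Q in auto)
    show "prob_space (distr M' ?B (\<lambda>\<omega>. knn_config k (Z \<omega>)))" by (rule M'.prob_space_distr[OF Ym])
    fix W :: "('a \<times> real) measure set" and e :: real
    assume W: "openin vague_topology W" and e: "e > 0"
    have Wm: "W \<in> sets ?B" by (rule vague_open_in_sets[OF W])
    obtain T :: "nat \<Rightarrow> (('a \<times> real) set \<times> nat) set" where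
      T': "\<forall>i. finite (T i) \<and> T i \<subseteq> B11 \<times> UNIV" and W_eq: "W = (\<Union>i. cylinder (T i))"
      using vague_open_eq_Union_cylinders[OF W] by (elim exE conjE) (rule that)
    have T: "finite (T i)" "T i \<subseteq> B11 \<times> UNIV" for i using T' by simp_all
    \<comment> \<open>\<open>W\<close> is approximated from inside by finitely many cylinders, whose
      constraints are confined to a common ball. The order of choice is \<open>m\<close>, then
      \<open>R\<close>, then \<open>u\<close>.\<close>
    define K where "K m = (\<Union>i<m. cylinder (T i))" for m
    define S where "S L = {\<omega> \<in> space M'. knn_config k (Z \<omega>) \<in> L}" for L
    have Km: "{x \<in> space N. f x \<in> K m} \<in> sets N"
      if f: "\<And>x. x \<in> space N \<Longrightarrow> f x \<in> configurations"
        and meas: "\<And>A. A \<in> B11 \<Longrightarrow> (\<lambda>x. emeasure (f x) A) \<in> borel_measurable N"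
      for N :: "'b measure" and f m
    proof -
      have "{x \<in> space N. f x \<in> K m} = (\<Union>i<m. {x \<in> space N. f x \<in> cylinder (T i)})"
        by (auto simp: K_def)
      also have "\<dots> \<in> sets N" using cylinder_event[OF T f meas] by (intro sets.finite_UN) auto
      finally show ?thesis .
    qed
    have Kpm: "{I \<in> locally_finite_sets. knn_config k (insert 0 I) \<in> K m} \<in> sets point_sets" for m
    proof -
      have "{I \<in> space point_sets. knn_config k (insert 0 I) \<in> K m} \<in> sets point_sets"
        by (rule Km)
          (auto intro!: knn_config_in_configurations insert_locally_finite
            measurable_compose[OF insert_measurable measurable_emeasure_knn_config[OF k]])
      then show ?thesis by simp
    qed
    have SK: "S (K m) \<in> sets M'" for m
    proof -
      have "(\<lambda>\<omega>. (\<lambda>i. U i \<omega>) ` {1..k}) \<in> measurable M' point_sets"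
        by (rule finite_sets_measurable) (use rv in auto)
      from measurable_sets[OF this Kpm[of m]]
      show ?thesis by (simp add: S_def Z_def vimage_def Int_def conj_commute finite_locally_finite)
    qed
    have "(\<lambda>m. measure M' (S (K m))) \<longlonglongrightarrow> measure M' (\<Union>m. S (K m))"
    proof (rule M'.finite_Lim_measure_incseq)
      show "range (\<lambda>m. S (K m)) \<subseteq> sets M'" using SK by auto
      show "incseq (\<lambda>m. S (K m))" by (force simp: incseq_def S_def K_def)
    qed
    moreover have "(\<Union>m. S (K m)) = S W" by (auto simp: S_def K_def W_eq)
    ultimately have "(\<lambda>m. measure M' (S (K m))) \<longlonglongrightarrow> measure M' (S W)" by simp
    \<comment> \<open>Half of \<open>e\<close> is spent on this truncation, the other half below on
      the factor \<open>x u\<close>.\<close>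
    then have "eventually (\<lambda>m. measure M' (S W) - e / 2 < measure M' (S (K m))) sequentially"
      using e by (intro order_tendstoD(1)) auto
    then obtain m where m: "measure M' (S W) - e / 2 < measure M' (S (K m))"
      by (auto simp: eventually_sequentially)
    obtain R where R: "R \<ge> 3" "\<And>D n. (D, n) \<in> (\<Union>i<m. T i) \<Longrightarrow> D \<subseteq> ball 0 R \<times> UNIV"
      using cylinder_base_bounded[of "\<Union>i<m. T i" 3] T by blast
    have Kloc: "knn_config k I \<in> K m \<longleftrightarrow> knn_config k (I \<inter> ball 0 R) \<in> K m"
      if I: "I \<in> locally_finite_sets" "I \<inter> ball 0 R \<subseteq> cball 0 1" "card (I \<inter> ball 0 R) = Suc k" for I
    proof -
      have "knn_config k I \<in> cylinder (T i) \<longleftrightarrow> knn_config k (I \<inter> ball 0 R) \<in> cylinder (T i)"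
        if "i < m" for i
        by (rule knn_config_local[OF I(1) R(1) I(2,3) T(2)]) (use R(2) that in auto)
      then show ?thesis by (auto simp: K_def)
    qed
    define x where "x u = exp (- (inverse u ^ DIM('a) * measure lborel (ball (0::'a) R)))" for u :: real
    \<comment> \<open>\<open>R\<close> is fixed by now; the dimension is at least 1, so
      \<open>0 ^ DIM('a) = 0\<close> and the limit is 1.\<close>
    have "(x \<longlongrightarrow> exp (- (0 ^ DIM('a) * measure lborel (ball (0::'a) R)))) at_top"
      unfolding x_def by (intro tendsto_intros tendsto_inverse_0_at_top filterlim_ident)
    then have "(x \<longlongrightarrow> 1) at_top"
      by (simp add: zero_power[OF DIM_positive])
    then have "((\<lambda>u. measure M' (S (K m)) * x u) \<longlongrightarrow> measure M' (S (K m)) * 1) at_top"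
      by (rule tendsto_mult[OF tendsto_const])
    then have "eventually (\<lambda>u. measure M' (S (K m)) - e / 2 < measure M' (S (K m)) * x u) at_top"
      using e by (intro order_tendstoD(1)) auto
    then show "eventually (\<lambda>u. measure (distr M' ?B (\<lambda>\<omega>. knn_config k (Z \<omega>))) W - e \<le> measure (Q u) W) at_top"
      using eventually_gt_at_top[of 0]
    proof eventually_elim
      case (elim u)
      have "measure (distr M' ?B (\<lambda>\<omega>. knn_config k (Z \<omega>))) W = measure M' (S W)"
        by (subst measure_distr[OF Ym Wm]) (auto simp: S_def intro!: arg_cong[of _ _ "measure M'"])
      moreover have "measure M' (S (K m)) * x u
          \<le> measure M {\<omega> \<in> A u. knn_config k (insert 0 ((*\<^sub>R) u ` P \<omega>)) \<in> K m} / measure M (A u)"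
        unfolding S_def Z_def x_def A_def
        by (rule knn_tail_lower_bound(3)[OF k P elim(2) R(1) M' iv d Kpm Kloc])
      moreover have "\<dots> \<le> measure M {\<omega> \<in> A u. knn_config k (insert 0 ((*\<^sub>R) u ` P \<omega>)) \<in> W} / measure M (A u)"
      proof (intro divide_right_mono M.finite_measure_mono)
        show "{\<omega> \<in> A u. knn_config k (insert 0 ((*\<^sub>R) u ` P \<omega>)) \<in> K m}
          \<subseteq> {\<omega> \<in> A u. knn_config k (insert 0 ((*\<^sub>R) u ` P \<omega>)) \<in> W}"
          by (auto simp: K_def W_eq)
        have "A u \<inter> ((\<lambda>\<omega>. knn_config k (insert 0 ((*\<^sub>R) u ` P \<omega>))) -` W \<inter> space M) \<in> sets M"
          by (intro sets.Int A(1)[OF elim(2)] measurable_sets[OF SXm[OF elim(2)] Wm])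
        also have "A u \<inter> ((\<lambda>\<omega>. knn_config k (insert 0 ((*\<^sub>R) u ` P \<omega>))) -` W \<inter> space M) =
            {\<omega> \<in> A u. knn_config k (insert 0 ((*\<^sub>R) u ` P \<omega>)) \<in> W}"
          by (auto simp: A_def)
        finally show "{\<omega> \<in> A u. knn_config k (insert 0 ((*\<^sub>R) u ` P \<omega>)) \<in> W} \<in> sets M" .
      qed simp
      ultimately show ?case
        using Q(3)[OF elim(2) Wm] elim(1) m by linarith
    qed
  qed simp
  then show ?thesis
    unfolding tail_configuration_of_palm_def Y_eq
    using M.prob_space_axioms M' Xm Ym AE_knn_config_score_gt_1[OF k M' iv d] regularly_varying_inverse
    by (simp add: X_eq Q_def[abs_def] A_def[abs_def] Z_def)
qed

end
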